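(* Let $m\ge3$ and let $M$ be an $m\times m$ integer matrix with nonzero determinant. Then $\mathbb Z^m=\langle x_1,\dots,x_m\rangle$ is area-undistorted in $\Gamma_M$ (i.e. $\mathrm{VolD}^2_{(\Gamma_M,\mathbb Z^m)}(n)\asymp n$) if and only if $M$ has finite order, i.e. $M^j=I$ for some $j\ge1$. In particular, for $M\in GL(m,\mathbb Z)$, $\mathbb Z^m$ is area-undistorted in $\mathbb Z^m\rtimes_M\mathbb Z$ if and only if $M$ has finite order.
   Context: For an $m\times m$ integer matrix $M=(a_{ji})$ with nonzero determinant, $\Gamma_M=\langle x_1,\dots,x_m,t\mid [x_i,x_j]=1,\ tx_it^{-1}=x_1^{a_{1i}}x_2^{a_{2i}}\cdots x_m^{a_{mi}}\ (1\le i,j\le m)\rangle$; when $\det M=\pm1$ this is $\mathbb Z^m\rtimes_M\mathbb Z$. For $H\le G$ of type $F_2$ (finitely presented), choose a $K(G,1)$ with finite $2$-skeleton containing a $K(H,1)$ subcomplex with finite $2$-skeleton, with universal cover $X$ and lift $Y\subseteq X$ of the universal cover of $K(H,1)$; the volume of a cellular $2$-chain $\sum\alpha_i\sigma_i$ is $\sum|\alpha_i|$, $FV^2_Z(z)$ is the minimal volume of a $2$-chain in $Z$ bounding the $1$-cycle $z$, and $\mathrm{VolD}^2_{(G,H)}(n)=\max\{FV^2_Y(z): z\text{ a }1\text{-cycle in }Y,\ FV^2_X(z)\le n\}$. $f\asymp g$ means $f(x)\le Cg(Cx+C)+Cx+C$ and $g(x)\le Cf(Cx+C)+Cx+C$ for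 some $C>0$. *)

theory Defs
  imports "Jordan_Normal_Form.Matrix" "Jordan_Normal_Form.Determinant" "HOL-Library.Extended_Real"
begin

text \<open>Generators of Gamma_M: X i (i < m, 0-indexed, standing for x_(i+1)) and T (standing for t).
  A letter is a generator with an exponent sign (True = +1, False = -1).\<close>

datatype gen = X nat | T

type_synonym letter = "gen \<times> bool"
type_synonym word = "letter list"

inductive weq :: "word set \<Rightarrow> word \<Rightarrow> word \<Rightarrow> bool" for R :: "word set" where
  weq_refl: "weq R u u"
| weq_sym: "weq R u v \<Longrightarrow> weq R v u"
| weq_trans: "weq R u v \<Longrightarrow> weq R v w \<Longrightarrow> weq R u w"
| weq_cancel: "weq R (u @ [(s, b), (s, \<not> b)] @ v) (u @ v)"
| weq_rel: "r \<in> R \<Longrightarrow> weq R (u @ r @ v) (u @ v)"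

text \<open>Group elements are equivalence classes of words.\<close>

definition cls :: "word set \<Rightarrow> word \<Rightarrow> word set" where
  "cls R w = {v. weq R w v}"

definition gmul :: "word set \<Rightarrow> word set \<Rightarrow> word \<Rightarrow> word set" where
  "gmul R g u = {v. \<exists>w\<in>g. weq R (w @ u) v}"

definition inv_word :: "word \<Rightarrow> word" where
  "inv_word u = rev (map (\<lambda>(s, b). (s, \<not> b)) u)"

definition pow_word :: "gen \<Rightarrow> int \<Rightarrow> word" where
  "pow_word s k = (if k \<ge> 0 then replicate (nat k) (s, True) else replicate (nat (- k)) (s, False))"

definition comm_rels :: "nat \<Rightarrow> word set" where
  "comm_rels m = {[(X i, True), (X j, True), (X i, False), (X j, False)] | i j. i < j \<and> j < m}"

definition conj_rel :: "nat \<Rightarrow> int mat \<Rightarrow> nat \<Rightarrow> word" where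
  "conj_rel m M i = [(T, True), (X i, True), (T, False)]
      @ inv_word (concat (map (\<lambda>j. pow_word (X j) (M $$ (j, i))) [0..<m]))"

definition gamma_rels :: "nat \<Rightarrow> int mat \<Rightarrow> word set" where
  "gamma_rels m M = comm_rels m \<union> {conj_rel m M i | i. i < m}"

definition x_gens :: "nat \<Rightarrow> gen set" where
  "x_gens m = {X i | i. i < m}"

definition gamma_gens :: "nat \<Rightarrow> gen set" where
  "gamma_gens m = x_gens m \<union> {T}"

definition x_words :: "nat \<Rightarrow> word set" where
  "x_words m = {u. set u \<subseteq> x_gens m \<times> UNIV}"

section \<open>Cellular chains on the universal cover of the presentation 2-complex (Cayley 2-complex)\<close>

text \<open>Edges are pairs (g, s): the edge from g to g s. 2-cells are pairs (g, r): the relator r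
  read from the base vertex g. Chains are finitely supported integer-valued functions on cells.\<close>

definition chain_supp :: "('a \<Rightarrow> int) \<Rightarrow> 'a set" where
  "chain_supp c = {e. c e \<noteq> 0}"

definition delta :: "'a \<Rightarrow> 'a \<Rightarrow> int" where
  "delta e = (\<lambda>e'. if e' = e then 1 else 0)"

fun path_chain :: "word set \<Rightarrow> word set \<Rightarrow> word \<Rightarrow> (word set \<times> gen) \<Rightarrow> int" where
  "path_chain R g [] = (\<lambda>_. 0)"
| "path_chain R g ((s, b) # u) =
     (if b then (\<lambda>e. delta (g, s) e + path_chain R (gmul R g [(s, True)]) u e)
      else (\<lambda>e. path_chain R (gmul R g [(s, False)]) u e - delta (gmul R g [(s, False)], s) e))"

definition bd1 :: "word set \<Rightarrow> (word set \<times> gen \<Rightarrow> int) \<Rightarrow> word set \<Rightarrow> int" where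
  "bd1 R z = (\<lambda>g. \<Sum>e\<in>chain_supp z. z e *
      ((if gmul R (fst e) [(snd e, True)] = g then 1 else 0) - (if fst e = g then 1 else 0)))"

definition bd2 :: "word set \<Rightarrow> (word set \<times> word \<Rightarrow> int) \<Rightarrow> word set \<times> gen \<Rightarrow> int" where
  "bd2 R c = (\<lambda>e. \<Sum>f\<in>chain_supp c. c f * path_chain R (fst f) (snd f) e)"

definition vol :: "('a \<Rightarrow> int) \<Rightarrow> int" where
  "vol c = (\<Sum>f\<in>chain_supp c. \<bar>c f\<bar>)"

definition chain_in :: "'a set \<Rightarrow> ('a \<Rightarrow> int) \<Rightarrow> bool" where
  "chain_in S c \<longleftrightarrow> finite (chain_supp c) \<and> chain_supp c \<subseteq> S"

text \<open>Filling volume of a 1-chain z using 2-cells from F (infinity if no filling exists).\<close>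

definition fillvol :: "word set \<Rightarrow> (word set \<times> word) set \<Rightarrow> (word set \<times> gen \<Rightarrow> int) \<Rightarrow> ereal" where
  "fillvol R F z = Inf {ereal (of_int (vol c)) | c. chain_in F c \<and> bd2 R c = z}"

definition verts_X :: "nat \<Rightarrow> int mat \<Rightarrow> word set set" where
  "verts_X m M = range (cls (gamma_rels m M))"

definition cells2_X :: "nat \<Rightarrow> int mat \<Rightarrow> (word set \<times> word) set" where
  "cells2_X m M = verts_X m M \<times> gamma_rels m M"

definition verts_Y :: "nat \<Rightarrow> int mat \<Rightarrow> word set set" where
  "verts_Y m M = cls (gamma_rels m M) ` x_words m"

definition edges_Y :: "nat \<Rightarrow> int mat \<Rightarrow> (word set \<times> gen) set" where
  "edges_Y m M = verts_Y m M \<times> x_gens m"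

definition cells2_Y :: "nat \<Rightarrow> int mat \<Rightarrow> (word set \<times> word) set" where
  "cells2_Y m M = verts_Y m M \<times> comm_rels m"

definition VolD :: "nat \<Rightarrow> int mat \<Rightarrow> real \<Rightarrow> ereal" where
  "VolD m M n = Sup {fillvol (gamma_rels m M) (cells2_Y m M) z | z.
       chain_in (edges_Y m M) z \<and> bd1 (gamma_rels m M) z = (\<lambda>_. 0)
       \<and> fillvol (gamma_rels m M) (cells2_X m M) z \<le> ereal n}"

definition asymp_equiv :: "(real \<Rightarrow> ereal) \<Rightarrow> (real \<Rightarrow> ereal) \<Rightarrow> bool" where
  "asymp_equiv f g \<longleftrightarrow> (\<exists>C>0. \<forall>x\<ge>0.
      f x \<le> ereal C * g (C * x + C) + ereal (C * x + C) \<and>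
      g x \<le> ereal C * f (C * x + C) + ereal (C * x + C))"

end

theory Submission
  imports Defs
begin

text \<open>For \<open>k \<ge> 0\<close> the coset of \<open>Y\<close> at height \<open>k\<close> is tiled by the larger cells \<open>M\<^sup>k e\<^sub>i \<and> M\<^sup>k e\<^sub>j\<close>.  A loop
  in \<open>Y\<close> with sides \<open>n M\<^sup>k e\<^sub>i\<close> and \<open>n M\<^sup>k e\<^sub>j\<close> therefore has filling volume at most \<open>n\<^sup>2 + O\<^sub>k(n)\<close> in \<open>X\<close>,
  whereas its filling volume in \<open>Y\<close> is at least \<open>n\<^sup>2\<close> times every \<open>2 \<times> 2\<close> minor of \<open>M\<^sup>k\<close> in the columns
  \<open>i, j\<close> (integrate \<open>dx\<^sub>a \<and> dx\<^sub>b\<close>).  So linear distortion bounds the integer matrices \<open>\<Lambda>\<^sup>2 M\<^sup>k\<close>; two of them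
  coincide, \<open>\<Lambda>\<^sup>2 M\<^sup>p = I\<close> for some \<open>p \<ge> 1\<close> because \<open>M\<close> is invertible over the rationals, and \<open>m \<ge> 3\<close> gives
  \<open>M\<^sup>p = \<plusminus>I\<close>.  Conversely, if \<open>M\<close> has finite order then \<open>(v, k) \<mapsto> v\<close> extends to a chain map retracting
  \<open>X\<close> onto \<open>Y\<close>; the images of 2-cells have only finitely many types up to translation, so volumes grow
  by a bounded factor.\<close>


section \<open>Finitely supported chains\<close>

text \<open>Evaluation of a cochain on a finitely supported chain. Both boundary operators have this
  form, so linearity and exchange of sums are proved once.\<close>

definition pair :: "('b \<Rightarrow> 'a::comm_ring_1) \<Rightarrow> ('b \<Rightarrow> int) \<Rightarrow> 'a" where
  "pair \<phi> c = (\<Sum>x\<in>chain_supp c. of_int (c x) * \<phi> x)"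

lemma pair_superset:
  assumes "finite S" "chain_supp c \<subseteq> S"
  shows "pair \<phi> c = (\<Sum>x\<in>S. of_int (c x) * \<phi> x)"
  unfolding pair_def
  by (rule sum.mono_neutral_left) (use assms in \<open>auto simp: chain_supp_def\<close>)

lemma chain_supp_zero [simp]: "chain_supp (\<lambda>_. 0) = {}"
  by (auto simp: chain_supp_def)

lemma chain_supp_delta [simp]: "chain_supp (delta x) = {x}"
  by (auto simp: chain_supp_def delta_def)

lemma chain_supp_add: "chain_supp (\<lambda>x. c x + d x) \<subseteq> chain_supp c \<union> chain_supp d"
  and chain_supp_diff: "chain_supp (\<lambda>x. c x - d x) \<subseteq> chain_supp c \<union> chain_supp d"
  by (auto simp: chain_supp_def)

lemma chain_supp_uminus [simp]: "chain_supp (\<lambda>x. - c x) = chain_supp c"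
  by (auto simp: chain_supp_def)

lemma pair_zero [simp]: "pair \<phi> (\<lambda>_. 0) = 0"
  by (simp add: pair_def)

lemma pair_delta [simp]: "pair \<phi> (delta x) = \<phi> x"
  unfolding pair_def chain_supp_delta by (simp add: delta_def)

lemma pair_add:
  assumes "finite (chain_supp c)" "finite (chain_supp d)"
  shows "pair \<phi> (\<lambda>x. c x + d x) = pair \<phi> c + pair \<phi> d"
proof -
  let ?S = "chain_supp c \<union> chain_supp d"
  have "finite ?S" using assms by blast
  then show ?thesis
    using pair_superset[of ?S "\<lambda>x. c x + d x" \<phi>] pair_superset[of ?S c \<phi>] pair_superset[of ?S d \<phi>]
      chain_supp_add[of c d]
    by (simp add: sum.distrib algebra_simps)
qed

lemma pair_uminus: "pair \<phi> (\<lambda>x. - c x) = - pair \<phi> c"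
  by (simp add: pair_def sum_negf)

lemma pair_diff:
  assumes "finite (chain_supp c)" "finite (chain_supp d)"
  shows "pair \<phi> (\<lambda>x. c x - d x) = pair \<phi> c - pair \<phi> d"
  using pair_add[of c "\<lambda>x. - d x" \<phi>] assms by (simp add: pair_uminus)

lemma chain_supp_pair:
  "chain_supp (\<lambda>e. pair (\<lambda>f. P f e) c) \<subseteq> (\<Union>f\<in>chain_supp c. chain_supp (P f))"
proof
  fix e assume "e \<in> chain_supp (\<lambda>e. pair (\<lambda>f. P f e) c)"
  then have "(\<Sum>f\<in>chain_supp c. of_int (c f) * P f e) \<noteq> 0"
    by (simp add: chain_supp_def pair_def)
  then obtain f where "f \<in> chain_supp c" "of_int (c f) * P f e \<noteq> 0"
    by (meson sum.neutral)
  then show "e \<in> (\<Union>f\<in>chain_supp c. chain_supp (P f))"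
    by (auto simp: chain_supp_def)
qed

text \<open>Exchange of finite sums. With \<open>P\<close> the boundaries of 2-cells this is Stokes'
  formula; with \<open>P\<close> a map on cells it makes the linear extension compatible with
  boundaries.\<close>

lemma pair_pair:
  assumes c: "finite (chain_supp c)"
    and P: "\<And>f. f \<in> chain_supp c \<Longrightarrow> finite (chain_supp (P f))"
  shows "pair \<phi> (\<lambda>e. pair (\<lambda>f. P f e) c) = pair (\<lambda>f. pair \<phi> (P f)) c"
proof -
  let ?S = "\<Union>f\<in>chain_supp c. chain_supp (P f)"
  have S: "finite ?S" using c P by blast
  have "pair \<phi> (\<lambda>e. pair (\<lambda>f. P f e) c)
      = (\<Sum>e\<in>?S. \<Sum>f\<in>chain_supp c. of_int (c f) * (of_int (P f e) * \<phi> e))"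
    by (subst pair_superset[OF S chain_supp_pair])
      (simp add: pair_def sum_distrib_right mult.assoc)
  also have "\<dots> = (\<Sum>f\<in>chain_supp c. \<Sum>e\<in>?S. of_int (c f) * (of_int (P f e) * \<phi> e))"
    by (rule sum.swap)
  also have "\<dots> = (\<Sum>f\<in>chain_supp c. of_int (c f) * pair \<phi> (P f))"
  proof (rule sum.cong[OF refl])
    fix f assume "f \<in> chain_supp c"
    then have "pair \<phi> (P f) = (\<Sum>e\<in>?S. of_int (P f e) * \<phi> e)"
      by (intro pair_superset S) blast
    then show "(\<Sum>e\<in>?S. of_int (c f) * (of_int (P f e) * \<phi> e)) = of_int (c f) * pair \<phi> (P f)"
      by (simp add: sum_distrib_left)
  qed
  finally show ?thesis by (simp add: pair_def)
qed

section \<open>Boundary operators and volume as sums over cells\<close>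

lemma bd1_pair:
  "bd1 R z g = pair (\<lambda>e. (if gmul R (fst e) [(snd e, True)] = g then 1 else 0)
      - (if fst e = g then 1 else 0)) z"
  by (simp add: bd1_def pair_def)

lemma bd2_pair: "bd2 R c e = pair (\<lambda>f. path_chain R (fst f) (snd f) e) c"
  by (simp add: bd2_def pair_def)

lemma vol_superset:
  assumes "finite S" "chain_supp c \<subseteq> S"
  shows "vol c = (\<Sum>x\<in>S. \<bar>c x\<bar>)"
  unfolding vol_def
  by (rule sum.mono_neutral_left) (use assms in \<open>auto simp: chain_supp_def\<close>)

lemma vol_nonneg: "0 \<le> vol c"
  by (simp add: vol_def sum_nonneg)

lemma vol_zero [simp]: "vol (\<lambda>_. 0) = 0"
  by (simp add: vol_def)

lemma vol_delta [simp]: "vol (delta x) = 1"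
  unfolding vol_def chain_supp_delta by (simp add: delta_def)

lemma vol_uminus [simp]: "vol (\<lambda>x. - c x) = vol c"
  by (simp add: vol_def)

lemma vol_add:
  assumes "finite (chain_supp c)" "finite (chain_supp d)"
  shows "vol (\<lambda>x. c x + d x) \<le> vol c + vol d"
proof -
  let ?S = "chain_supp c \<union> chain_supp d"
  have "finite ?S" using assms by blast
  then have "vol (\<lambda>x. c x + d x) = (\<Sum>x\<in>?S. \<bar>c x + d x\<bar>)" "vol c = (\<Sum>x\<in>?S. \<bar>c x\<bar>)"
    "vol d = (\<Sum>x\<in>?S. \<bar>d x\<bar>)"
    using chain_supp_add[of c d] by (auto intro!: vol_superset)
  then show ?thesis
    by (simp add: sum.distrib[symmetric] sum_mono)
qed

text \<open>Triangle inequality after exchanging the sums. Later \<open>P\<close> sends each 2-cell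
  of X to a filling in Y of bounded volume.\<close>

lemma vol_pair:
  assumes c: "finite (chain_supp c)"
    and P: "\<And>f. f \<in> chain_supp c \<Longrightarrow> finite (chain_supp (P f)) \<and> vol (P f) \<le> N"
  shows "vol (\<lambda>x. pair (\<lambda>f. P f x) c) \<le> N * vol c"
proof -
  let ?S = "\<Union>f\<in>chain_supp c. chain_supp (P f)"
  have S: "finite ?S" using c P by blast
  have "vol (\<lambda>x. pair (\<lambda>f. P f x) c) = (\<Sum>x\<in>?S. \<bar>\<Sum>f\<in>chain_supp c. c f * P f x\<bar>)"
    by (subst vol_superset[OF S chain_supp_pair]) (simp add: pair_def)
  also have "\<dots> \<le> (\<Sum>x\<in>?S. \<Sum>f\<in>chain_supp c. \<bar>c f\<bar> * \<bar>P f x\<bar>)"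
    by (intro sum_mono order_trans[OF sum_abs]) (simp add: abs_mult)
  also have "\<dots> = (\<Sum>f\<in>chain_supp c. \<Sum>x\<in>?S. \<bar>c f\<bar> * \<bar>P f x\<bar>)"
    by (rule sum.swap)
  also have "\<dots> = (\<Sum>f\<in>chain_supp c. \<bar>c f\<bar> * vol (P f))"
  proof (rule sum.cong[OF refl])
    fix f assume "f \<in> chain_supp c"
    then have "vol (P f) = (\<Sum>x\<in>?S. \<bar>P f x\<bar>)"
      by (intro vol_superset S) blast
    then show "(\<Sum>x\<in>?S. \<bar>c f\<bar> * \<bar>P f x\<bar>) = \<bar>c f\<bar> * vol (P f)"
      by (simp add: sum_distrib_left)
  qed
  also have "\<dots> \<le> (\<Sum>f\<in>chain_supp c. \<bar>c f\<bar> * N)"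
    by (intro sum_mono mult_left_mono) (use P in auto)
  also have "\<dots> = N * vol c"
    by (simp add: vol_def sum_distrib_left mult.commute)
  finally show ?thesis .
qed

text \<open>The calibration inequality, meant for the coboundary of a 1-form.\<close>

lemma abs_pair_le_vol:
  fixes \<phi> :: "'b \<Rightarrow> int"
  assumes "\<And>x. x \<in> chain_supp c \<Longrightarrow> \<bar>\<phi> x\<bar> \<le> 1"
  shows "\<bar>pair \<phi> c\<bar> \<le> vol c"
proof -
  have "\<bar>pair \<phi> c\<bar> \<le> (\<Sum>x\<in>chain_supp c. \<bar>c x\<bar> * \<bar>\<phi> x\<bar>)"
    unfolding pair_def by (intro order_trans[OF sum_abs]) (simp add: abs_mult)
  also have "\<dots> \<le> (\<Sum>x\<in>chain_supp c. \<bar>c x\<bar> * 1)"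
    by (intro sum_mono mult_left_mono) (use assms in auto)
  finally show ?thesis by (simp add: vol_def)
qed

section \<open>Words, vertices and paths\<close>

lemma weq_ctx: "weq R u v \<Longrightarrow> weq R (a @ u @ b) (a @ v @ b)"
proof (induction rule: weq.induct)
  case (weq_cancel u s b' v)
  show ?case using weq.weq_cancel[of R "a @ u" s b' "v @ b"] by simp
next
  case (weq_rel r u v)
  then show ?case using weq.weq_rel[of r R "a @ u" "v @ b"] by simp
qed (blast intro: weq.intros)+

lemma weq_append: "weq R u u' \<Longrightarrow> weq R v v' \<Longrightarrow> weq R (u @ v) (u' @ v')"
  using weq_ctx[of R u u' "[]" v] weq_ctx[of R v v' u' "[]"] weq_trans by fastforce

lemma cls_eq_iff: "cls R u = cls R v \<longleftrightarrow> weq R u v"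
  unfolding cls_def by (auto intro: weq.intros)

lemma gmul_cls [simp]: "gmul R (cls R w) u = cls R (w @ u)"
  unfolding gmul_def cls_def by (auto intro: weq_trans weq_append weq_refl)

lemma path_chain_append:
  "path_chain R (cls R w) (u @ v) e = path_chain R (cls R w) u e + path_chain R (cls R (w @ u)) v e"
proof (induction u arbitrary: w)
  case (Cons x u)
  then show ?case by (cases x) auto
qed simp

lemma chain_supp_path_chain_finite [simp]: "finite (chain_supp (path_chain R g u))"
proof (induction u arbitrary: g)
  case (Cons x u)
  obtain s b where x: "x = (s, b)" by fastforce
  show ?case
    using finite_subset[OF chain_supp_add[of "delta (g, s)" "path_chain R (gmul R g [x]) u"]]
      finite_subset[OF chain_supp_diff[of "path_chain R (gmul R g [x]) u" "delta (gmul R g [x], s)"]]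
      Cons[of "gmul R g [x]"]
    by (cases b) (simp_all add: x)
qed simp

lemma pair_path_chain_Cons:
  "pair \<phi> (path_chain R g ((s, b) # u)) =
     (if b then \<phi> (g, s) else - \<phi> (gmul R g [(s, b)], s)) + pair \<phi> (path_chain R (gmul R g [(s, b)]) u)"
  by (simp add: pair_add pair_diff)

lemma pair_path_chain_append:
  "pair \<phi> (path_chain R (cls R w) (u @ v)) =
     pair \<phi> (path_chain R (cls R w) u) + pair \<phi> (path_chain R (cls R (w @ u)) v)"
proof -
  have "path_chain R (cls R w) (u @ v)
      = (\<lambda>e. path_chain R (cls R w) u e + path_chain R (cls R (w @ u)) v e)"
    by (rule ext) (rule path_chain_append)
  then show ?thesis by (simp add: pair_add)
qed

lemma weq_cancel_snoc: "weq R (w @ [(s, b), (s, \<not> b)]) w"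
  using weq_cancel[of R w s b "[]"] by simp

lemma cls_cancel [simp]:
  "cls R (w @ [(s, True), (s, False)]) = cls R w" "cls R (w @ [(s, False), (s, True)]) = cls R w"
  using weq_cancel_snoc[of R w s True] weq_cancel_snoc[of R w s False] by (simp_all add: cls_eq_iff)

lemma path_chain_cancel: "path_chain R (cls R w) [(s, b), (s, \<not> b)] = (\<lambda>_. 0)"
  by (cases b) (auto simp: fun_eq_iff)

text \<open>Contributions telescope along the path. Hence equivalent words read from a common vertex
  give paths that differ by a cycle.\<close>

lemma bd1_path_chain:
  "bd1 R (path_chain R (cls R w) u) h
    = (if cls R (w @ u) = h then 1 else 0) - (if cls R w = h then 1 else 0)"
proof (induction u arbitrary: w)
  case (Cons x u)
  obtain s b where x: "x = (s, b)" by fastforce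
  show ?case
    using Cons[of "w @ [x]"] unfolding bd1_pair x pair_path_chain_Cons
    by (cases b) auto
qed (simp add: bd1_pair)

lemma inv_word_Nil [simp]: "inv_word [] = []"
  and inv_word_Cons: "inv_word ((s, b) # u) = inv_word u @ [(s, \<not> b)]"
  by (simp_all add: inv_word_def)

lemma set_inv_word: "set (inv_word u) = (\<lambda>(s, b). (s, \<not> b)) ` set u"
  by (simp add: inv_word_def)

lemma inv_word_inv_word [simp]: "inv_word (inv_word u) = u"
  by (simp add: inv_word_def rev_map comp_def case_prod_beta)

lemma weq_inv_word_right: "weq R (u @ inv_word u) []"
proof (induction u)
  case (Cons x u)
  obtain s b where x: "x = (s, b)" by fastforce
  have "weq R ([x] @ (u @ inv_word u) @ [(s, \<not> b)]) ([x] @ [] @ [(s, \<not> b)])"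
    using Cons by (rule weq_ctx)
  moreover have "weq R ([x] @ [] @ [(s, \<not> b)]) []"
    using weq_cancel[of R "[]" s b "[]"] by (simp add: x)
  ultimately show ?case
    unfolding x inv_word_Cons by (auto intro: weq_trans)
qed (simp add: weq_refl)

lemma weq_inv_word_left: "weq R (inv_word u @ u) []"
  using weq_inv_word_right[of R "inv_word u"] by simp

lemma weq_inv_word: assumes "weq R u v" shows "weq R (inv_word u) (inv_word v)"
proof -
  have "weq R (inv_word u @ v @ inv_word v) (inv_word u @ [])"
    by (intro weq_append weq_inv_word_right weq_refl)
  moreover have "weq R ((inv_word u @ v) @ inv_word v) ((inv_word u @ u) @ inv_word v)"
    by (intro weq_append weq_refl weq_sym[OF assms])
  moreover have "weq R ((inv_word u @ u) @ inv_word v) ([] @ inv_word v)"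
    by (intro weq_append weq_inv_word_left weq_refl)
  ultimately show ?thesis
    by (metis append.assoc append.right_neutral append_Nil weq_sym weq_trans)
qed

text \<open>The path of \<open>inv_word u @ u\<close> backtracks completely and has zero chain;
  splitting it at the turning point gives the sign.\<close>

lemma path_chain_inv_word:
  "path_chain R (cls R w) (inv_word u) e = - path_chain R (cls R (w @ inv_word u)) u e"
proof -
  have "path_chain R (cls R w) (inv_word u @ u) e = 0"
  proof (induction u arbitrary: w)
    case (Cons x u)
    obtain s b where x: "x = (s, b)" by fastforce
    have "path_chain R (cls R w) (inv_word u @ [(s, \<not> b), (s, b)] @ u) e
      = path_chain R (cls R w) (inv_word u @ u) e"
      unfolding path_chain_append
      using path_chain_cancel[of R "w @ inv_word u" s "\<not> b"]
        weq_cancel_snoc[of R "w @ inv_word u" s "\<not> b"]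
      by (simp add: cls_eq_iff[symmetric] del: path_chain.simps)
    then show ?case using Cons by (simp add: x inv_word_Cons)
  qed simp
  then show ?thesis by (simp add: path_chain_append)
qed


section \<open>Homotopies of bounded area\<close>

lemma weq_mono: "weq R u v \<Longrightarrow> R \<subseteq> R' \<Longrightarrow> weq R' u v"
  by (induction rule: weq.induct) (blast intro: weq.intros)+

text \<open>\<open>weq {}\<close> is equality in the free group. A cancelling pair traverses an edge
  back and forth, so free rewriting will cost no area.\<close>

lemma path_chain_free_eq:
  "weq {} u v \<Longrightarrow> path_chain R (cls R w) u = path_chain R (cls R w) v"
proof (induction rule: weq.induct)
  case (weq_cancel u s b v)
  have "cls R (w @ u @ [(s, b), (s, \<not> b)]) = cls R (w @ u)"
    using weq_cancel_snoc[of R "w @ u" s b] by (simp add: cls_eq_iff)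
  then show ?case
    using path_chain_cancel[of R "w @ u" s b]
    by (simp only: fun_eq_iff path_chain_append append.assoc) simp
qed auto

text \<open>Fillings by cells with relators \<open>S\<close> based at vertices \<open>V\<close>;
  along letters of \<open>A\<close> the base vertex stays in \<open>V\<close>. The two instances are
  X, with everything allowed, and Y, with commutators, vertices of Y and x-letters.\<close>

locale filling =
  fixes R S :: "word set" and V :: "word set set" and A :: "letter set"
  assumes S_subset: "S \<subseteq> R"
    and V_cls: "g \<in> V \<Longrightarrow> \<exists>w. g = cls R w"
    and V_closed: "g \<in> V \<Longrightarrow> set u \<subseteq> A \<Longrightarrow> gmul R g u \<in> V"
begin

text \<open>Homological area of rewriting \<open>u\<close> into \<open>v\<close>. Asking for the
  bound at every base vertex at once replaces translating fillings by the group action.\<close>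

definition fills :: "nat \<Rightarrow> word \<Rightarrow> word \<Rightarrow> bool" where
  "fills N u v \<longleftrightarrow> weq R u v \<and> (\<forall>g\<in>V. \<exists>c. chain_in (V \<times> S) c \<and> vol c \<le> int N \<and>
      (\<forall>e. bd2 R c e = path_chain R g u e - path_chain R g v e))"

lemma fills_weq: "fills N u v \<Longrightarrow> weq R u v"
  by (simp add: fills_def)

lemma fills_mono: "fills N u v \<Longrightarrow> N \<le> N' \<Longrightarrow> fills N' u v"
  unfolding fills_def by (meson of_nat_mono order_trans)

lemma fills_free:
  assumes "weq {} u v"
  shows "fills N u v"
  unfolding fills_def
proof (intro conjI ballI)
  fix g assume "g \<in> V"
  then obtain w where g: "g = cls R w" using V_cls by blast
  show "\<exists>c. chain_in (V \<times> S) c \<and> vol c \<le> int N \<and>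
      (\<forall>e. bd2 R c e = path_chain R g u e - path_chain R g v e)"
    using path_chain_free_eq[OF assms, of R w]
    by (intro exI[of _ "\<lambda>_. 0"]) (simp add: chain_in_def g bd2_pair)
qed (rule weq_mono[OF assms], simp)

lemma fills_refl: "fills N u u"
  by (rule fills_free) (rule weq_refl)

lemma fills_sym: assumes "fills N u v" shows "fills N v u"
  unfolding fills_def
proof (intro conjI ballI)
  show "weq R v u" using assms by (auto simp: fills_def intro: weq_sym)
  fix g assume "g \<in> V"
  then obtain c where "chain_in (V \<times> S) c" "vol c \<le> int N"
    "\<And>e. bd2 R c e = path_chain R g u e - path_chain R g v e"
    using assms unfolding fills_def by blast
  then show "\<exists>c. chain_in (V \<times> S) c \<and> vol c \<le> int N \<and>
      (\<forall>e. bd2 R c e = path_chain R g v e - path_chain R g u e)"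
    by (intro exI[of _ "\<lambda>x. - c x"]) (simp add: chain_in_def bd2_pair pair_uminus)
qed

lemma fills_trans:
  assumes "fills N u v" "fills N' v w"
  shows "fills (N + N') u w"
  unfolding fills_def
proof (intro conjI ballI)
  show "weq R u w" using assms by (auto simp: fills_def intro: weq_trans)
  fix g assume g: "g \<in> V"
  from g obtain c where c: "chain_in (V \<times> S) c" "vol c \<le> int N"
    "\<And>e. bd2 R c e = path_chain R g u e - path_chain R g v e"
    using assms unfolding fills_def by blast
  from g obtain d where d: "chain_in (V \<times> S) d" "vol d \<le> int N'"
    "\<And>e. bd2 R d e = path_chain R g v e - path_chain R g w e"
    using assms unfolding fills_def by blast
  have fin: "finite (chain_supp c)" "finite (chain_supp d)"
    using c d by (auto simp: chain_in_def)
  show "\<exists>c. chain_in (V \<times> S) c \<and> vol c \<le> int (N + N') \<and>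
      (\<forall>e. bd2 R c e = path_chain R g u e - path_chain R g w e)"
  proof (intro exI[of _ "\<lambda>x. c x + d x"] conjI allI)
    show "chain_in (V \<times> S) (\<lambda>x. c x + d x)"
      using c(1) d(1) chain_supp_add[of c d] unfolding chain_in_def
      by (meson finite_UnI finite_subset le_sup_iff order_trans)
    show "vol (\<lambda>x. c x + d x) \<le> int (N + N')"
      using vol_add[OF fin] c(2) d(2) by simp
    show "bd2 R (\<lambda>x. c x + d x) e = path_chain R g u e - path_chain R g w e" for e
      using c(3)[of e] d(3)[of e] by (simp add: bd2_pair pair_add[OF fin])
  qed
qed

text \<open>The prefix moves the base vertex, so its letters must come from \<open>A\<close>. The
  two copies of the suffix start at the same vertex and cancel in the difference.\<close>

lemma fills_ctx:
  assumes "fills N u v" "set a \<subseteq> A"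
  shows "fills N (a @ u @ b) (a @ v @ b)"
  unfolding fills_def
proof (intro conjI ballI)
  show "weq R (a @ u @ b) (a @ v @ b)" using assms by (auto simp: fills_def intro: weq_ctx)
  fix g assume "g \<in> V"
  then obtain w where g: "g = cls R w" and "gmul R g a \<in> V"
    using V_cls V_closed assms(2) by blast
  then obtain c where c: "chain_in (V \<times> S) c" "vol c \<le> int N"
    "\<And>e. bd2 R c e = path_chain R (cls R (w @ a)) u e - path_chain R (cls R (w @ a)) v e"
    using assms(1) unfolding fills_def by fastforce
  have "cls R (w @ a @ u) = cls R (w @ a @ v)"
    using weq_append[OF weq_refl fills_weq[OF assms(1)], of "w @ a"] by (simp add: cls_eq_iff)
  then show "\<exists>c. chain_in (V \<times> S) c \<and> vol c \<le> int N \<and>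
      (\<forall>e. bd2 R c e = path_chain R g (a @ u @ b) e - path_chain R g (a @ v @ b) e)"
    using c by (intro exI[of _ c]) (simp add: g path_chain_append)
qed

lemma fills_append:
  assumes "fills N u u'" "fills N' v v'" "set u' \<subseteq> A"
  shows "fills (N + N') (u @ v) (u' @ v')"
  using fills_trans[of N "u @ v" "u' @ v" N'] fills_ctx[OF assms(1), of "[]" v]
    fills_ctx[OF assms(2,3), of "[]"] by simp

lemma fills_relator: assumes "r \<in> S" shows "fills 1 r []"
  unfolding fills_def
proof (intro conjI ballI)
  show "weq R r []" using weq_rel[of r R "[]" "[]"] assms S_subset by auto
  fix g assume "g \<in> V"
  then show "\<exists>c. chain_in (V \<times> S) c \<and> vol c \<le> int 1 \<and>
      (\<forall>e. bd2 R c e = path_chain R g r e - path_chain R g [] e)"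
    using assms by (intro exI[of _ "delta (g, r)"]) (simp add: chain_in_def bd2_pair)
qed

lemma fills_concat_replicate:
  assumes "fills N u v" "set v \<subseteq> A"
  shows "fills (n * N) (concat (replicate n u)) (concat (replicate n v))"
proof (induction n)
  case (Suc n)
  then show ?case using fills_append[OF assms(1) Suc assms(2)] by simp
qed (simp add: fills_refl)

text \<open>Writing s' for the inverse letter: s' y is freely s' (y s) s', one exchange makes it s'
  (s y) s', which is freely y s'. Only the exchange costs area.\<close>

lemma fills_commute_inv:
  assumes "fills N [(s, b), y] [y, (s, b)]" "(s, \<not> b) \<in> A"
  shows "fills N [(s, \<not> b), y] [y, (s, \<not> b)]"
proof -
  have 1: "weq {} [(s, \<not> b), y] ([(s, \<not> b)] @ [y, (s, b)] @ [(s, \<not> b)])"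
    using weq_sym[OF weq_cancel[of "{}" "[(s, \<not> b), y]" s b "[]"]] by simp
  have 2: "weq {} ([(s, \<not> b)] @ [(s, b), y] @ [(s, \<not> b)]) [y, (s, \<not> b)]"
    using weq_cancel[of "{}" "[]" s "\<not> b" "[y, (s, \<not> b)]"] by simp
  have 3: "fills N ([(s, \<not> b)] @ [y, (s, b)] @ [(s, \<not> b)])
      ([(s, \<not> b)] @ [(s, b), y] @ [(s, \<not> b)])"
    by (rule fills_ctx[OF fills_sym[OF assms(1)]]) (use assms in auto)
  show ?thesis
    using fills_trans[OF fills_trans[OF fills_free[OF 1, of 0] 3] fills_free[OF 2, of 0]] by simp
qed

text \<open>Relators cost one cell, cancellations nothing. \<open>N\<close> depends on the
  derivation but not on the base vertex, which is enough for words fixed in advance.\<close>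

lemma weq_imp_fills:
  assumes "S = R" "A = UNIV" and "weq R u v"
  shows "\<exists>N. fills N u v"
  using assms(3)
proof (induction rule: weq.induct)
  case (weq_cancel u s b v)
  then show ?case using fills_free weq.weq_cancel by blast
next
  case (weq_rel r u v)
  then have "fills 1 (u @ r @ v) (u @ [] @ v)"
    using assms(1,2) by (intro fills_ctx fills_relator) auto
  then show ?case by auto
qed (blast intro: fills_refl fills_sym fills_trans)+

end

section \<open>Exponents and commuting generators\<close>

definition xexp :: "word \<Rightarrow> nat \<Rightarrow> int" where
  "xexp u a = (\<Sum>(s, b)\<leftarrow>u. if s = X a then (if b then 1 else - 1) else 0)"

lemma xexp_Nil [simp]: "xexp [] a = 0"
  and xexp_Cons: "xexp ((s, b) # u) a = (if s = X a then (if b then 1 else - 1) else 0) + xexp u a"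
  and xexp_append [simp]: "xexp (u @ v) a = xexp u a + xexp v a"
  by (simp_all add: xexp_def)

lemma xexp_inv_word [simp]: "xexp (inv_word u) a = - xexp u a"
proof (induction u)
  case (Cons x u)
  then show ?case by (cases x) (simp add: inv_word_Cons xexp_Cons)
qed simp

definition vec_word :: "nat \<Rightarrow> (nat \<Rightarrow> int) \<Rightarrow> word" where
  "vec_word m c = concat (map (\<lambda>j. pow_word (X j) (c j)) [0..<m])"

lemma xexp_replicate: "xexp (replicate n (s, b)) a = (if s = X a then (if b then int n else - int n) else 0)"
  by (induction n) (auto simp: xexp_Cons)

lemma xexp_vec_word: "xexp (vec_word m c) a = (if a < m then c a else 0)"
  by (induction m) (auto simp: vec_word_def xexp_replicate pow_word_def less_Suc_eq)

lemma x_words_Nil [simp]: "[] \<in> x_words m"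
  and x_words_Cons: "(s, b) # u \<in> x_words m \<longleftrightarrow> s \<in> x_gens m \<and> u \<in> x_words m"
  and x_words_append [simp]: "u @ v \<in> x_words m \<longleftrightarrow> u \<in> x_words m \<and> v \<in> x_words m"
  by (auto simp: x_words_def)

lemma x_gens_X [simp]: "X i \<in> x_gens m \<longleftrightarrow> i < m"
  by (auto simp: x_gens_def)

lemma x_words_inv_word [simp]: "inv_word u \<in> x_words m \<longleftrightarrow> u \<in> x_words m"
  by (auto simp: x_words_def set_inv_word)

lemma x_words_vec_word [simp]: "vec_word m c \<in> x_words m"
  by (auto simp: x_words_def vec_word_def pow_word_def split: if_splits)

lemma xexp_x_words_ge: "u \<in> x_words m \<Longrightarrow> m \<le> a \<Longrightarrow> xexp u a = 0"
proof (induction u)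
  case (Cons x u)
  then show ?case by (cases x) (auto simp: xexp_Cons x_words_Cons)
qed simp

locale commuting_filling = filling +
  fixes m :: nat
  assumes comm_S: "comm_rels m \<subseteq> S" and x_A: "x_gens m \<times> UNIV \<subseteq> A"
begin

text \<open>Relators exist only for \<open>i < j\<close> and a positive leading pair. Symmetry gives
  the other order, \<open>i = j\<close> is trivial, and signs are flipped one letter at a time by
  \<open>fills_commute_inv\<close>.\<close>

lemma fills_swap:
  assumes "i < m" "j < m"
  shows "fills 1 [(X i, b), (X j, b')] [(X j, b'), (X i, b)]"
proof -
  have A: "(X i, c) \<in> A" "(X j, c) \<in> A" for c using assms x_A by auto
  have pos: "fills 1 [(X i, True), (X j, True)] [(X j, True), (X i, True)]"
    if ij: "i < j" "j < m" for i j
  proof -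
    let ?r = "[(X i, True), (X j, True), (X i, False), (X j, False)]"
    have "?r \<in> S" using ij comm_S by (auto simp: comm_rels_def)
    then have 1: "fills 1 ([] @ ?r @ [(X j, True), (X i, True)]) ([] @ [] @ [(X j, True), (X i, True)])"
      by (intro fills_ctx fills_relator) auto
    have 2: "weq {} [(X i, True), (X j, True)] (?r @ [(X j, True), (X i, True)])"
      using weq_cancel[of "{}" "[(X i, True), (X j, True), (X i, False)]" "X j" False "[(X i, True)]"]
        weq_cancel[of "{}" "[(X i, True), (X j, True)]" "X i" False "[]"]
      by (auto intro: weq_sym weq_trans)
    show ?thesis
      using fills_trans[OF fills_free[OF 2, of 0]] 1 by simp
  qed
  have pos: "fills 1 [(X i, True), (X j, True)] [(X j, True), (X i, True)]"
    using pos[of i j] pos[of j i] assms fills_sym fills_refl by (metis nat_neq_iff)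
  have "fills 1 [(X i, b), (X j, True)] [(X j, True), (X i, b)]"
    using pos fills_commute_inv[OF pos] A by (cases b) auto
  then have *: "fills 1 [(X j, True), (X i, b)] [(X i, b), (X j, True)]"
    by (rule fills_sym)
  then have "fills 1 [(X j, b'), (X i, b)] [(X i, b), (X j, b')]"
    using fills_commute_inv[OF *] A by (cases b') auto
  then show ?thesis by (rule fills_sym)
qed

text \<open>A p by q rectangle cut into unit squares. The coefficient 1 matters: it later makes the
  bound on the minors independent of the height.\<close>

lemma fills_swap_replicate:
  assumes "i < m" "j < m"
  shows "fills (p * q) (replicate p (X i, b) @ replicate q (X j, b'))
    (replicate q (X j, b') @ replicate p (X i, b))"
proof -
  let ?x = "(X i, b)" and ?y = "(X j, b')"
  have A: "?x \<in> A" "?y \<in> A" using assms x_A by auto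
  have single: "fills q ([?x] @ replicate q ?y) (replicate q ?y @ [?x])" for q
  proof (induction q)
    case (Suc q)
    have 1: "fills 1 ([] @ [?x, ?y] @ replicate q ?y) ([] @ [?y, ?x] @ replicate q ?y)"
      by (intro fills_ctx fills_swap assms) auto
    have 2: "fills q ([?y] @ ([?x] @ replicate q ?y) @ []) ([?y] @ (replicate q ?y @ [?x]) @ [])"
      using A by (intro fills_ctx Suc) auto
    show ?case using fills_trans[of 1 "[?x] @ replicate (Suc q) ?y" "[?y, ?x] @ replicate q ?y" q] 1 2 by simp
  qed (simp add: fills_refl)
  show ?thesis
  proof (induction p)
    case (Suc p)
    have 1: "fills (p * q) ([?x] @ (replicate p ?x @ replicate q ?y) @ [])
        ([?x] @ (replicate q ?y @ replicate p ?x) @ [])"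
      using A by (intro fills_ctx Suc) auto
    have 2: "fills q ([] @ ([?x] @ replicate q ?y) @ replicate p ?x)
        ([] @ (replicate q ?y @ [?x]) @ replicate p ?x)"
      by (intro fills_ctx single) auto
    show ?case using fills_trans[of "p * q" "replicate (Suc p) ?x @ replicate q ?y"
        "[?x] @ replicate q ?y @ replicate p ?x" q] 1 2 by (simp add: add.commute)
  qed (simp add: fills_refl)
qed

lemma fills_rotate:
  assumes "i < m" "u \<in> x_words m"
  shows "\<exists>N. fills N ((X i, b) # u) (u @ [(X i, b)])"
  using assms(2)
proof (induction u)
  case (Cons x u)
  then obtain j b' where x: "x = (X j, b')" "j < m" "u \<in> x_words m"
    by (cases x) (auto simp: x_words_Cons x_gens_def)
  then obtain N where N: "fills N ((X i, b) # u) (u @ [(X i, b)])" using Cons by blast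
  have 1: "fills 1 ([] @ [(X i, b), x] @ u) ([] @ [x, (X i, b)] @ u)"
    unfolding x by (intro fills_ctx fills_swap x assms) auto
  have 2: "fills N ([x] @ ((X i, b) # u) @ []) ([x] @ (u @ [(X i, b)]) @ [])"
    using N by (rule fills_ctx) (use x_A x in auto)
  show ?case using fills_trans[of 1 "(X i, b) # x # u" "[x, (X i, b)] @ u" N] 1 2 by auto
qed (auto intro: fills_refl)

text \<open>Rotate the first letter to an occurrence of its inverse, cancel the pair, and induct on
  the length.\<close>

lemma xexp_zero_fills:
  assumes "u \<in> x_words m" "\<And>a. a < m \<Longrightarrow> xexp u a = 0"
  shows "\<exists>N. fills N u []"
  using assms
proof (induction u rule: length_induct)
  case (1 u)
  show ?case
  proof (cases u)
    case (Cons x v)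
    then obtain i b where x: "x = (X i, b)" "i < m" and v: "v \<in> x_words m"
      using 1(2) by (cases x) (auto simp: x_words_Cons x_gens_def)
    \<comment> \<open>Were the inverse absent, every occurrence of \<open>X i\<close> would carry
      the same sign and the exponent sum could not vanish.\<close>
    have "(X i, \<not> b) \<in> set v"
    proof (rule ccontr)
      assume "(X i, \<not> b) \<notin> set v"
      then have "if b then xexp v i \<ge> 0 else xexp v i \<le> 0"
      proof (induction v)
        case (Cons y v)
        then show ?case by (cases y) (auto simp: xexp_Cons split: if_splits)
      qed simp
      then show False using 1(3)[OF x(2)] by (auto simp: Cons x xexp_Cons split: if_splits)
    qed
    then obtain v1 v2 where v12: "v = v1 @ (X i, \<not> b) # v2" by (meson split_list)
    then have v1: "v1 \<in> x_words m" "v2 \<in> x_words m" using v by (auto simp: x_words_Cons)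
    obtain N where "fills N ((X i, b) # v1) (v1 @ [(X i, b)])"
      using fills_rotate[OF x(2) v1(1)] by blast
    then have "fills N ([] @ ((X i, b) # v1) @ ((X i, \<not> b) # v2))
        ([] @ (v1 @ [(X i, b)]) @ ((X i, \<not> b) # v2))"
      by (rule fills_ctx) simp
    moreover have "fills 0 (v1 @ [(X i, b), (X i, \<not> b)] @ v2) (v1 @ v2)"
      by (intro fills_free weq_cancel)
    ultimately have "fills (N + 0) u (v1 @ v2)"
      using fills_trans[of N u "v1 @ [(X i, b), (X i, \<not> b)] @ v2" 0] by (simp add: Cons x v12)
    moreover have "\<exists>N. fills N (v1 @ v2) []"
    proof -
      have "length (v1 @ v2) < length u" by (simp add: Cons v12)
      moreover have "xexp (v1 @ v2) a = 0" if "a < m" for a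
        using 1(3)[OF that] by (auto simp: Cons x v12 xexp_Cons split: if_splits)
      ultimately show ?thesis using 1(1) v1 by simp
    qed
    ultimately show ?thesis using fills_trans by blast
  qed (auto intro: fills_refl)
qed

lemma xexp_eq_weq:
  assumes "u \<in> x_words m" "v \<in> x_words m" "\<And>a. a < m \<Longrightarrow> xexp u a = xexp v a"
  shows "weq R u v"
proof -
  have "\<exists>N. fills N (u @ inv_word v) []"
    using assms by (intro xexp_zero_fills) auto
  then have "weq R ((u @ inv_word v) @ v) ([] @ v)"
    using fills_weq by (intro weq_append weq_refl) blast
  moreover have "weq R (u @ (inv_word v @ v)) (u @ [])"
    by (intro weq_append weq_refl weq_inv_word_left)
  ultimately show ?thesis by (auto intro: weq_sym weq_trans)
qed

end


section \<open>The affine action of words\<close>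

lemma gamma_rels_cases:
  assumes "r \<in> gamma_rels m M"
  obtains i j where "i < m" "j < m" "r = [(X i, True), (X j, True), (X i, False), (X j, False)]"
  | i where "i < m" "r = [(T, True), (X i, True), (T, False)] @ inv_word (vec_word m (\<lambda>j. M $$ (j, i)))"
  using assms less_trans unfolding gamma_rels_def comm_rels_def conj_rel_def vec_word_def by blast

text \<open>\<open>pw k a i\<close> plays the role of the entry \<open>(M\<^sup>k)\<^sub>a\<^sub>i\<close>, for \<open>k\<close> of either sign.\<close>

locale power_rep =
  fixes m :: nat and M :: "int mat" and pw :: "int \<Rightarrow> nat \<Rightarrow> nat \<Rightarrow> 'a::comm_ring_1"
  assumes pw_0: "i < m \<Longrightarrow> pw 0 a i = (if a = i then 1 else 0)"
    and pw_Suc: "i < m \<Longrightarrow> pw (k + 1) a i = (\<Sum>j<m. pw k a j * of_int (M $$ (j, i)))"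
begin

abbreviation R :: "word set" where "R \<equiv> gamma_rels m M"

text \<open>Right multiplication by a letter in the semidirect product, in terms of position and
  height: at height \<open>k\<close>, \<open>X i\<close> translates by column \<open>i\<close> of
  the k-th power. Words may also contain \<open>X i\<close> with \<open>i \<ge> m\<close>; such
  letters act trivially.\<close>

fun act :: "(nat \<Rightarrow> 'a) \<times> int \<Rightarrow> letter \<Rightarrow> (nat \<Rightarrow> 'a) \<times> int" where
  "act (v, k) (X i, b) =
     (\<lambda>a. v a + (if i < m then (if b then pw k a i else - pw k a i) else 0), k)"
| "act (v, k) (T, b) = (v, if b then k + 1 else k - 1)"

definition run :: "(nat \<Rightarrow> 'a) \<times> int \<Rightarrow> word \<Rightarrow> (nat \<Rightarrow> 'a) \<times> int" where
  "run = foldl act"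

lemma run_Nil [simp]: "run s [] = s"
  and run_Cons [simp]: "run s (x # u) = run (act s x) u"
  and run_append [simp]: "run s (u @ v) = run (run s u) v"
  by (simp_all add: run_def)

lemma run_x_word:
  assumes "u \<in> x_words m"
  shows "run (v, k) u = (\<lambda>a. v a + (\<Sum>j<m. pw k a j * of_int (xexp u j)), k)"
  using assms
proof (induction u arbitrary: v)
  case (Cons x u)
  then obtain i b where x: "x = (X i, b)" "i < m" "u \<in> x_words m"
    by (cases x) (auto simp: x_words_Cons x_gens_def)
  have "(\<Sum>j<m. pw k a j * of_int (xexp (x # u) j)) =
      (\<Sum>j<m. (if i = j then (if b then pw k a j else - pw k a j) else 0)
        + pw k a j * of_int (xexp u j))" for a
    by (intro sum.cong) (auto simp: x xexp_Cons algebra_simps)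
  then have "(\<Sum>j<m. pw k a j * of_int (xexp (x # u) j)) =
      (if b then pw k a i else - pw k a i) + (\<Sum>j<m. pw k a j * of_int (xexp u j))" for a
    by (simp add: sum.distrib x)
  then show ?case using Cons.IH x by (simp add: add.assoc)
qed simp

lemma run_x_word_0:
  assumes "u \<in> x_words m" "a < m"
  shows "fst (run (v, 0) u) a = v a + of_int (xexp u a)"
proof -
  have "(\<Sum>j<m. pw 0 a j * of_int (xexp u j)) = (\<Sum>j<m. if a = j then of_int (xexp u j) else 0)"
    by (intro sum.cong) (auto simp: pw_0)
  then show ?thesis using assms by (simp add: run_x_word)
qed

lemma run_cancel: "run s [(x, b), (x, \<not> b)] = s"
  by (cases s; cases x; cases b) (auto simp: fun_eq_iff)

text \<open>In the conjugation relator \<open>X i\<close> is read at height \<open>k + 1\<close> and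
  the inverse word at height \<open>k\<close>; by \<open>pw_Suc\<close> the two translations
  cancel.\<close>

lemma run_relator: assumes "r \<in> R" shows "run s r = s"
proof -
  obtain v k where s: "s = (v, k)" by fastforce
  show ?thesis using assms
  proof (cases rule: gamma_rels_cases)
    case (2 i)
    have "run (v', k) (inv_word (vec_word m (\<lambda>j. M $$ (j, i)))) = (\<lambda>a. v' a - pw (k + 1) a i, k)" for v'
      using 2 by (subst run_x_word) (simp_all add: xexp_vec_word pw_Suc sum_negf)
    then show ?thesis using 2 by (simp add: s)
  qed (auto simp: s fun_eq_iff)
qed

lemma run_weq: "weq R u v \<Longrightarrow> run s u = run s v"
proof (induction arbitrary: s rule: weq.induct)
  case (weq_cancel u x b v)
  show ?case by (simp only: run_append run_cancel)
next
  case (weq_rel r u v)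
  then show ?case by (simp add: run_relator)
qed auto

definition pos :: "word set \<Rightarrow> (nat \<Rightarrow> 'a) \<times> int" where
  "pos g = run (\<lambda>_. 0, 0) (SOME w. w \<in> g)"

lemma pos_cls: "pos (cls R w) = run (\<lambda>_. 0, 0) w"
proof -
  have "w \<in> cls R w" by (simp add: cls_def weq_refl)
  then have "(SOME w'. w' \<in> cls R w) \<in> cls R w" by (rule someI)
  then have "weq R w (SOME w'. w' \<in> cls R w)" by (simp add: cls_def)
  then show ?thesis unfolding pos_def by (simp add: run_weq)
qed

lemma run_replicate_T:
  "run (v, k) (replicate n (T, b)) = (v, if b then k + int n else k - int n)"
  by (induction n arbitrary: k) auto

end

text \<open>From height 0 an x-word translates by its exponent vector, and the action factors
  through the group; so Z^m embeds in Gamma_M. Characteristic zero recovers the integers from ring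
  values.\<close>

lemma weq_x_words_xexp:
  fixes pw :: "int \<Rightarrow> nat \<Rightarrow> nat \<Rightarrow> 'a::{comm_ring_1,ring_char_0}"
  assumes "power_rep m M pw" "u \<in> x_words m" "v \<in> x_words m" "weq (gamma_rels m M) u v" 
  shows "xexp u a = xexp v a"
proof -
  interpret power_rep m M pw by fact
  show ?thesis
  proof (cases "a < m")
    case True
    have "of_int (xexp u a) = (of_int (xexp v a) :: 'a)"
      using run_x_word_0[OF assms(2) True, of "\<lambda>_. 0"] run_x_word_0[OF assms(3) True, of "\<lambda>_. 0"]
        run_weq[OF assms(4)] by simp
    then show ?thesis by simp
  next
    case False
    then show ?thesis using assms xexp_x_words_ge by simp
  qed
qed

lemma commuting_filling_X:
  "commuting_filling (gamma_rels m M) (gamma_rels m M) (range (cls (gamma_rels m M))) UNIV m"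
  by unfold_locales (auto simp: gamma_rels_def)

lemma commuting_filling_Y:
  "commuting_filling (gamma_rels m M) (comm_rels m) (verts_Y m M) (x_gens m \<times> UNIV) m"
  by unfold_locales (auto simp: gamma_rels_def verts_Y_def x_words_def)

section \<open>The retraction for a matrix of finite order\<close>

lemma finite_gamma_rels: "finite (gamma_rels m M)"
proof -
  have "comm_rels m \<subseteq> (\<lambda>(i, j). [(X i, True), (X j, True), (X i, False), (X j, False)]) ` ({..<m} \<times> {..<m})"
    using less_trans by (fastforce simp: comm_rels_def)
  then have "finite (comm_rels m)" by (rule finite_subset) simp
  moreover have "{conj_rel m M i |i. i < m} = conj_rel m M ` {..<m}" by auto
  ultimately show ?thesis by (simp add: gamma_rels_def)
qed

text \<open>Integer entries at every height let all columns be spelled by words; periodicity leaves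
  finitely many such words.\<close>

locale periodic_power_rep = power_rep m M pw
  for m :: nat and M :: "int mat" and pw :: "int \<Rightarrow> nat \<Rightarrow> nat \<Rightarrow> int" +
  fixes p :: int
  assumes p_pos: "p > 0" and pw_periodic: "pw (k + p) = pw k"
begin

sublocale Y: commuting_filling "gamma_rels m M" "comm_rels m" "verts_Y m M" "x_gens m \<times> UNIV" m
  by (rule commuting_filling_Y)

definition wcol :: "int \<Rightarrow> nat \<Rightarrow> word" where
  "wcol k i = (if i < m then vec_word m (\<lambda>j. pw k j i) else [])"

text \<open>Image, under the retraction forgetting the height, of a path starting at height
  \<open>k\<close>.\<close>

fun img :: "int \<Rightarrow> word \<Rightarrow> word" where
  "img k [] = []"
| "img k ((X i, b) # u) = (if b then wcol k i else inv_word (wcol k i)) @ img k u"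
| "img k ((T, b) # u) = img (if b then k + 1 else k - 1) u"

definition rho :: "word set \<Rightarrow> word set" where
  "rho g = cls R (vec_word m (fst (pos g)))"

definition F1 :: "word set \<times> gen \<Rightarrow> word set \<times> gen \<Rightarrow> int" where
  "F1 = (\<lambda>(g, s). case s of X i \<Rightarrow> path_chain R (rho g) (wcol (snd (pos g)) i) | T \<Rightarrow> (\<lambda>_. 0))"

lemma wcol_x_words [simp]: "wcol k i \<in> x_words m"
  by (simp add: wcol_def)

lemma xexp_wcol: "a < m \<Longrightarrow> xexp (wcol k i) a = (if i < m then pw k a i else 0)"
  by (simp add: wcol_def xexp_vec_word)

lemma img_x_words: "img k u \<in> x_words m"
  by (induction k u rule: img.induct) auto

lemma run_img: "a < m \<Longrightarrow> fst (run (v, k) u) a = v a + xexp (img k u) a"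
  by (induction k u arbitrary: v rule: img.induct) (auto simp: xexp_wcol)

lemma img_periodic: "img (k + p) u = img k u"
proof (induction k u rule: img.induct)
  case (3 k b u)
  then show ?case by (cases b) (auto simp: algebra_simps)
qed (auto simp: wcol_def pw_periodic)

lemma img_mod: "img (k mod p) u = img k u"
proof -
  have *: "img (k + p * int n) u = img k u" for k n
  proof (induction n)
    case (Suc n)
    have "k + p * int (Suc n) = (k + p * int n) + p" by (simp add: algebra_simps)
    then show ?case using Suc img_periodic[of "k + p * int n" u] by metis
  qed simp
  show ?thesis
  proof (cases "k div p \<ge> 0")
    case True
    have "k = k mod p + p * int (nat (k div p))" using True by simp
    then show ?thesis using * by metis
  next
    case False
    have "k mod p = k + p * int (nat (- (k div p)))" using False
      by (simp add: minus_mult_div_eq_mod[symmetric])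
    then show ?thesis using * by metis
  qed
qed

lemma rho_step:
  assumes "\<And>a. a < m \<Longrightarrow> fst (pos (cls R w')) a = fst (pos (cls R w)) a + xexp u a"
    and "u \<in> x_words m"
  shows "rho (cls R w') = gmul R (rho (cls R w)) u"
  unfolding rho_def gmul_cls cls_eq_iff
  by (rule Y.xexp_eq_weq) (use assms in \<open>auto simp: xexp_vec_word\<close>)

lemma rho_id: assumes "g \<in> verts_Y m M" shows "rho g = g" and "snd (pos g) = 0"
proof -
  obtain w where w: "g = cls R w" "w \<in> x_words m" using assms by (auto simp: verts_Y_def)
  show "rho g = g"
    unfolding rho_def w cls_eq_iff pos_cls
    by (rule Y.xexp_eq_weq) (auto simp: xexp_vec_word w run_x_word_0)
  show "snd (pos g) = 0" by (simp add: w pos_cls run_x_word)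
qed

lemma rho_in_verts_Y: "rho g \<in> verts_Y m M"
  by (auto simp: rho_def verts_Y_def)

text \<open>\<open>F1\<close> extends linearly to the retraction on 1-chains. An inverse letter uses
  the edge based at its far end, matched by \<open>path_chain_inv_word\<close>; t-edges vanish
  because \<open>rho\<close> is constant along them.\<close>

lemma pair_F1_path:
  "pair (\<lambda>e'. F1 e' e) (path_chain R (cls R w) u)
    = path_chain R (rho (cls R w)) (img (snd (pos (cls R w))) u) e"
proof (induction u arbitrary: w)
  case (Cons x u)
  obtain s b where x: "x = (s, b)" by fastforce
  obtain v k where rw: "run (\<lambda>_. 0, 0) w = (v, k)" by fastforce
  have pk: "snd (pos (cls R w)) = k" by (simp add: pos_cls rw)
  have IH: "pair (\<lambda>e'. F1 e' e) (path_chain R (gmul R (cls R w) [(s, b)]) u) =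
    path_chain R (rho (cls R (w @ [x]))) (img (snd (pos (cls R (w @ [x])))) u) e"
    using Cons[of "w @ [x]"] by (simp add: x)
  show ?case
  proof (cases s)
    case (X i)
    let ?u = "if b then wcol k i else inv_word (wcol k i)"
    have k': "snd (pos (cls R (w @ [x]))) = k" by (simp add: pos_cls rw x X)
    have rho: "rho (cls R (w @ [x])) = gmul R (rho (cls R w)) ?u"
      by (rule rho_step) (auto simp: pos_cls rw x X xexp_wcol)
    obtain w0 where w0: "rho (cls R w) = cls R w0" by (simp add: rho_def)
    have "(if b then F1 (cls R w, s) e else - F1 (gmul R (cls R w) [(s, b)], s) e)
      = path_chain R (rho (cls R w)) ?u e"
      using rho k' pk by (auto simp: F1_def X x w0 path_chain_inv_word)
    moreover have "path_chain R (rho (cls R w)) (?u @ v) e = path_chain R (rho (cls R w)) ?u e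
        + path_chain R (rho (cls R (w @ [x]))) v e" for v
      unfolding rho w0 gmul_cls by (rule path_chain_append)
    moreover have "img k (x # u) = ?u @ img k u" by (simp add: x X)
    ultimately show ?thesis
      unfolding x pair_path_chain_Cons IH[unfolded x] using k' pk by (simp only: x)
  next
    case T
    have k': "snd (pos (cls R (w @ [x]))) = (if b then k + 1 else k - 1)"
      by (simp add: pos_cls rw x T)
    have rho: "rho (cls R (w @ [x])) = rho (cls R w)"
      by (simp add: rho_def pos_cls rw x T)
    show ?thesis
      unfolding x pair_path_chain_Cons IH[unfolded x]
      using rho k' pk by (simp add: T F1_def x)
  qed
qed simp

lemma F1_edge_Y: assumes "e' \<in> edges_Y m M" shows "F1 e' = delta e'"
proof -
  obtain g i where e': "e' = (g, X i)" "g \<in> verts_Y m M" "i < m"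
    using assms by (auto simp: edges_Y_def x_gens_def)
  obtain w where w: "g = cls R w" using e' by (auto simp: verts_Y_def)
  \<comment> \<open>A unit vector is spelled by the single letter itself, not just by an equivalent
    word, so the retraction fixes edges of Y exactly.\<close>
  have "vec_word n (\<lambda>j. if j = i then 1 else 0) = (if i < n then [(X i, True)] else [])" for n
    by (induction n) (auto simp: vec_word_def pow_word_def)
  then have "wcol 0 i = [(X i, True)]"
    using e' by (simp add: wcol_def pw_0)
  then show ?thesis using e' rho_id[of g] by (auto simp: F1_def fun_eq_iff)
qed

lemma pair_F1_Y:
  assumes "chain_supp z \<subseteq> edges_Y m M" "finite (chain_supp z)"
  shows "pair (\<lambda>e'. F1 e' e) z = z e"
proof -
  have "pair (\<lambda>e'. F1 e' e) z = (\<Sum>e'\<in>chain_supp z. if e = e' then z e' else 0)"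
    unfolding pair_def using assms F1_edge_Y by (intro sum.cong) (auto simp: delta_def)
  also have "\<dots> = z e" using assms(2) by (auto simp: chain_supp_def)
  finally show ?thesis .
qed

text \<open>Relators act trivially, so their images have zero exponent sums and can be filled in Y.
  By periodicity finitely many words occur, and the maximum of their bounds serves all
  heights.\<close>

lemma img_relator_fills: "\<exists>N. \<forall>k. \<forall>r\<in>gamma_rels m M. Y.fills N (img k r) []"
proof -
  let ?W = "(\<lambda>(k, r). img k r) ` ({0..<p} \<times> gamma_rels m M)"
  have "\<exists>N. Y.fills N (img k r) []" if "r \<in> gamma_rels m M" for k r
    using run_img[of _ "\<lambda>_. 0" k r] run_relator[OF that] img_x_words
    by (intro Y.xexp_zero_fills) auto
  then have "\<forall>w\<in>?W. \<exists>N. Y.fills N w []" by auto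
  then obtain N where N: "\<And>w. w \<in> ?W \<Longrightarrow> Y.fills (N w) w []"
    using bchoice[of ?W "\<lambda>w N. Y.fills N w []"] by blast
  have fin: "finite ?W" using finite_gamma_rels by simp
  have "Y.fills (Max (N ` ?W)) (img k r) []" if r: "r \<in> gamma_rels m M" for k r
  proof -
    have "k mod p \<in> {0..<p}" using p_pos by simp
    then have W: "img k r \<in> ?W" using r img_mod[of k r, symmetric]
      by (intro image_eqI[of _ _ "(k mod p, r)"]) simp_all
    then have "N (img k r) \<le> Max (N ` ?W)" using fin by (intro Max_ge) auto
    then show ?thesis using Y.fills_mono[OF N[OF W]] by blast
  qed
  then show ?thesis by blast
qed

text \<open>Replace each 2-cell by a chosen filling \<open>P\<close> of its retracted boundary and
  extend linearly. The result bounds the retraction of \<open>z\<close>, which is \<open>z\<close>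
  itself as \<open>z\<close> lies in Y.\<close>

lemma fill_transfer:
  "\<exists>N. \<forall>z c. chain_in (edges_Y m M) z \<longrightarrow> chain_in (cells2_X m M) c \<longrightarrow> bd2 R c = z \<longrightarrow>
     (\<exists>c'. chain_in (cells2_Y m M) c' \<and> bd2 R c' = z \<and> vol c' \<le> int N * vol c)"
proof -
  obtain N where N: "\<And>k r. r \<in> gamma_rels m M \<Longrightarrow> Y.fills N (img k r) []"
    using img_relator_fills by blast
  let ?Q = "\<lambda>g r c. chain_in (cells2_Y m M) c \<and> vol c \<le> int N \<and>
      (\<forall>e. bd2 R c e = path_chain R (rho g) (img (snd (pos g)) r) e)"
  define P where "P f = (SOME c. ?Q (fst f) (snd f) c)" for f
  have P: "?Q g r (P (g, r))" if "r \<in> R" for g r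
  proof -
    have "\<exists>c. ?Q g r c"
      using N[OF that, of "snd (pos g)"] rho_in_verts_Y[of g] unfolding Y.fills_def cells2_Y_def
      by simp
    then show ?thesis unfolding P_def fst_conv snd_conv by (rule someI_ex)
  qed
  show ?thesis
  proof (intro exI[of _ N] allI impI)
    fix z c assume z: "chain_in (edges_Y m M) z" and c: "chain_in (cells2_X m M) c" and bd: "bd2 R c = z"
    let ?c = "\<lambda>x. pair (\<lambda>f. P f x) c"
    have supp: "\<exists>w r. f = (cls R w, r) \<and> r \<in> R" if "f \<in> chain_supp c" for f
      using that c by (fastforce simp: chain_in_def cells2_X_def verts_X_def)
    then have P': "chain_in (cells2_Y m M) (P f)" "vol (P f) \<le> int N" if "f \<in> chain_supp c" for f
      using P that by blast+
    have fin: "finite (chain_supp c)" using c by (simp add: chain_in_def)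
    have sub: "chain_supp ?c \<subseteq> (\<Union>f\<in>chain_supp c. chain_supp (P f))" by (rule chain_supp_pair)
    have "chain_in (cells2_Y m M) ?c"
      using P'(1) fin finite_subset[OF sub] sub unfolding chain_in_def by fast
    moreover have "vol ?c \<le> int N * vol c"
      using P' by (intro vol_pair fin) (auto simp: chain_in_def)
    moreover have "bd2 R ?c e = z e" for e
    proof -
      have "bd2 R ?c e = pair (\<lambda>f. bd2 R (P f) e) c"
        unfolding bd2_pair by (rule pair_pair[OF fin]) (use P' in \<open>auto simp: chain_in_def\<close>)
      also have "\<dots> = pair (\<lambda>f. pair (\<lambda>e'. F1 e' e) (path_chain R (fst f) (snd f))) c"
        unfolding pair_def[of _ c]
      proof (intro sum.cong refl arg_cong2[of _ _ _ _ "(*)"])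
        fix f assume "f \<in> chain_supp c"
        then obtain w r where "f = (cls R w, r)" "r \<in> R" using supp by blast
        then show "bd2 R (P f) e = pair (\<lambda>e'. F1 e' e) (path_chain R (fst f) (snd f))"
          by (simp only: fst_conv snd_conv pair_F1_path P)
      qed
      also have "\<dots> = pair (\<lambda>e'. F1 e' e) (\<lambda>e'. pair (\<lambda>f. path_chain R (fst f) (snd f) e') c)"
        by (rule pair_pair[OF fin, symmetric]) simp
      also have "\<dots> = pair (\<lambda>e'. F1 e' e) z"
        using bd by (simp add: bd2_pair[symmetric])
      also have "\<dots> = z e" using z by (intro pair_F1_Y) (auto simp: chain_in_def)
      finally show ?thesis .
    qed
    ultimately show "\<exists>c'. chain_in (cells2_Y m M) c' \<and> bd2 R c' = z \<and> vol c' \<le> int N * vol c"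
      by blast
  qed
qed

end


section \<open>Parallelogram loops pushed along the stable letter\<close>

locale faithful_power_rep = power_rep m M pw
  for m :: nat and M :: "int mat" and pw :: "int \<Rightarrow> nat \<Rightarrow> nat \<Rightarrow> 'a::{comm_ring_1,ring_char_0}"
begin

sublocale Z: commuting_filling "gamma_rels m M" "gamma_rels m M" "range (cls (gamma_rels m M))" UNIV m
  by (rule commuting_filling_X)

section \<open>Coordinates on Y and the lower bound by Stokes\<close>

lemma weq_xexp: "u \<in> x_words m \<Longrightarrow> v \<in> x_words m \<Longrightarrow> weq R u v \<Longrightarrow> xexp u a = xexp v a"
  using weq_x_words_xexp[OF power_rep_axioms] .

text \<open>The choice is restricted to x-words because a vertex of Y also has representatives
  involving \<open>T\<close>.\<close>

definition yexp :: "word set \<Rightarrow> nat \<Rightarrow> int" where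
  "yexp g a = xexp (SOME w. w \<in> g \<and> w \<in> x_words m) a"

lemma yexp_cls: assumes "w \<in> x_words m" shows "yexp (cls R w) a = xexp w a"
proof -
  let ?P = "\<lambda>v. v \<in> cls R w \<and> v \<in> x_words m"
  have "?P w" using assms by (simp add: cls_def weq_refl)
  then have "?P (SOME v. ?P v)" by (rule someI)
  then show ?thesis unfolding yexp_def using weq_xexp[OF assms, of "SOME v. ?P v"]
    by (simp only: cls_def mem_Collect_eq)
qed

text \<open>The 1-form \<open>x\<^sub>a dx\<^sub>b\<close>, whose differential \<open>dx\<^sub>a \<and> dx\<^sub>b\<close> takes values in \<open>{-1, 0, 1}\<close> on unit
  squares; by Stokes it bounds filling volumes in \<open>Y\<close> from below.\<close>

definition omega :: "nat \<Rightarrow> nat \<Rightarrow> word set \<times> gen \<Rightarrow> int" where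
  "omega a b = (\<lambda>(g, s). if s = X b then yexp g a else 0)"

lemma omega_cls [simp]:
  "w \<in> x_words m \<Longrightarrow> omega a b (cls R w, s) = (if s = X b then xexp w a else 0)"
  by (simp add: omega_def yexp_cls)

text \<open>Translation by \<open>w\<close> adds the constant \<open>xexp w a\<close> to the
  coefficient of the form, hence that constant times the total displacement in direction b to the
  integral.\<close>

lemma pair_omega_path:
  assumes "w \<in> x_words m" "u \<in> x_words m"
  shows "pair (omega a b) (path_chain R (cls R w) u)
    = xexp w a * xexp u b + pair (omega a b) (path_chain R (cls R []) u)"
  using assms(2)
proof (induction u rule: rev_induct)
  case (snoc x u)
  then obtain i c where x: "x = (X i, c)" "i < m" and u: "u \<in> x_words m"
    by (cases x) (auto simp: x_words_Cons x_gens_def)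
  \<comment> \<open>A negative letter runs along the edge based at its far endpoint, whence the
    correction \<open>xexp [x] a\<close>.\<close>
  have last: "pair (omega a b) (path_chain R (cls R v) [x])
      = (if i = b then (if c then xexp v a else - xexp v a - xexp [x] a) else 0)"
    if "v \<in> x_words m" for v
    unfolding x pair_path_chain_Cons using that x(2) by (simp add: x_words_Cons)
  show ?case
    unfolding pair_path_chain_append
    using snoc.IH[OF u] assms(1) u
    by (simp only: last x_words_append append_Nil xexp_append) (auto simp: x xexp_Cons algebra_simps)
qed simp

lemma abs_omega_square:
  assumes "w \<in> x_words m" "r \<in> comm_rels m"
  shows "\<bar>pair (omega a b) (path_chain R (cls R w) r)\<bar> \<le> 1"
proof -
  obtain i j where r: "r = [(X i, True), (X j, True), (X i, False), (X j, False)]" and ij: "i < j" "j < m"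
    using assms(2) by (auto simp: comm_rels_def)
  have "pair (omega a b) (path_chain R (cls R w) r) =
      (if i = a \<and> j = b then 1 else 0) - (if i = b \<and> j = a then 1 else 0)"
  proof -
    have im: "i < m" "i \<noteq> j" using ij by auto
    show ?thesis
      unfolding r pair_path_chain_Cons
      using im ij(2) assms(1)
      by (cases "i = a"; cases "j = a"; cases "i = b"; cases "j = b")
        (simp_all add: x_words_Cons xexp_Cons)
  qed
  moreover have "\<bar>(if P then 1 else 0) - (if Q then 1 else 0) :: int\<bar> \<le> 1" for P Q
    by simp
  ultimately show ?thesis by (simp only:)
qed

lemma omega_le_vol:
  assumes "chain_in (cells2_Y m M) c"
  shows "\<bar>pair (omega a b) (bd2 R c)\<bar> \<le> vol c"
proof -
  have "pair (omega a b) (bd2 R c)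
      = pair (\<lambda>f. pair (omega a b) (path_chain R (fst f) (snd f))) c"
    unfolding bd2_pair[abs_def] using assms by (intro pair_pair) (auto simp: chain_in_def)
  also have "\<bar>\<dots>\<bar> \<le> vol c"
    using assms abs_omega_square
    by (intro abs_pair_le_vol) (fastforce simp: chain_in_def cells2_Y_def verts_Y_def)
  finally show ?thesis .
qed

lemma chain_supp_path_Y:
  assumes "w \<in> x_words m" "u \<in> x_words m"
  shows "chain_supp (path_chain R (cls R w) u) \<subseteq> edges_Y m M"
  using assms
proof (induction u arbitrary: w)
  case (Cons x u)
  obtain s b where x: "x = (s, b)" by fastforce
  then have s: "s \<in> x_gens m" "u \<in> x_words m" using Cons by (auto simp: x_words_Cons)
  have "chain_supp (path_chain R (cls R (w @ [x])) u) \<subseteq> edges_Y m M"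
    using Cons x s by (simp add: x_words_Cons)
  moreover have "(cls R w, s) \<in> edges_Y m M" "(cls R (w @ [x]), s) \<in> edges_Y m M"
    using Cons.prems s x by (auto simp: edges_Y_def verts_Y_def x_words_Cons)
  moreover have "chain_supp (path_chain R (cls R w) (x # u))
      \<subseteq> {(cls R w, s), (cls R (w @ [x]), s)} \<union> chain_supp (path_chain R (cls R (w @ [x])) u)"
  proof (cases b)
    case True
    then show ?thesis
      using chain_supp_add[of "delta (cls R w, s)" "path_chain R (cls R (w @ [x])) u"]
      by (simp add: x) blast
  next
    case False
    then show ?thesis
      using chain_supp_diff[of "path_chain R (cls R (w @ [x])) u" "delta (cls R (w @ [x]), s)"]
      by (simp add: x) blast
  qed
  ultimately show ?case by blast
qed simp

section \<open>Conjugation by powers of the stable letter\<close>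

lemma weq_conj_letter:
  assumes "i < m"
  shows "\<exists>w\<in>x_words m. weq R [(T, True), (X i, b), (T, False)] w"
proof -
  let ?t = "[(T, True), (X i, True), (T, False)]" and ?w = "vec_word m (\<lambda>j. M $$ (j, i))"
  have "?t @ inv_word ?w \<in> R"
    using assms by (auto simp: gamma_rels_def conj_rel_def vec_word_def)
  then have "weq R ((?t @ inv_word ?w) @ ?w) ([] @ ?w)"
    using weq_rel[of "?t @ inv_word ?w" R "[]" ?w] by simp
  moreover have "weq R (?t @ (inv_word ?w @ ?w)) (?t @ [])"
    by (intro weq_append weq_refl weq_inv_word_left)
  ultimately have w: "weq R ?t ?w" by (auto intro: weq_sym weq_trans)
  have "weq R [(T, True), (X i, False), (T, False)] (inv_word ?w)"
    using weq_inv_word[OF w] by (simp add: inv_word_def)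
  then show ?thesis using w by (cases b) (auto intro: bexI[of _ ?w] bexI[of _ "inv_word ?w"])
qed

text \<open>Insert a cancelling pair of \<open>T\<close> letters after each letter and conjugate
  letterwise. Only this direction keeps Z^m invariant for every integer matrix, so loops are pushed
  to heights \<open>k \<ge> 0\<close>.\<close>

lemma weq_conj_x_word:
  assumes "u \<in> x_words m"
  shows "\<exists>w\<in>x_words m. weq R ([(T, True)] @ u @ [(T, False)]) w"
  using assms
proof (induction u)
  case Nil
  then show ?case using weq_cancel[of R "[]" T True "[]"] by (intro bexI[of _ "[]"]) auto
next
  case (Cons x u)
  then obtain i b where x: "x = (X i, b)" "i < m" "u \<in> x_words m"
    by (cases x) (auto simp: x_words_Cons x_gens_def)
  obtain w where w: "w \<in> x_words m" "weq R ([(T, True)] @ u @ [(T, False)]) w"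
    using Cons x by blast
  obtain v where v: "v \<in> x_words m" "weq R [(T, True), x, (T, False)] v"
    using weq_conj_letter x by blast
  have "weq R [(T, True), x, (T, False), (T, True)] [(T, True), x]"
    using weq_cancel[of R "[(T, True), x]" T False "[]"] by simp
  then have "weq R ([(T, True), x] @ (u @ [(T, False)]))
      ([(T, True), x, (T, False), (T, True)] @ (u @ [(T, False)]))"
    by (intro weq_append weq_refl) (rule weq_sym)
  moreover have "weq R ([(T, True), x, (T, False)] @ ([(T, True)] @ u @ [(T, False)])) (v @ w)"
    by (intro weq_append v w)
  ultimately have "weq R ([(T, True)] @ (x # u) @ [(T, False)]) (v @ w)"
    by (auto intro: weq_trans)
  then show ?case using v w by (intro bexI[of _ "v @ w"]) auto
qed

definition up :: "nat \<Rightarrow> word \<Rightarrow> word" where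
  "up k u = replicate k (T, True) @ u @ replicate k (T, False)"

lemma weq_up_x_word:
  assumes "u \<in> x_words m"
  shows "\<exists>w\<in>x_words m. weq R (up k u) w"
proof (induction k)
  case (Suc k)
  then obtain w where w: "w \<in> x_words m" "weq R (up k u) w" by blast
  obtain v where v: "v \<in> x_words m" "weq R ([(T, True)] @ w @ [(T, False)]) v"
    using weq_conj_x_word w by blast
  have "weq R ([(T, True)] @ up k u @ [(T, False)]) ([(T, True)] @ w @ [(T, False)])"
    by (rule weq_ctx) (rule w)
  moreover have "up (Suc k) u = [(T, True)] @ up k u @ [(T, False)]"
    by (simp add: up_def replicate_append_same)
  ultimately show ?case using v by (auto intro: weq_trans)
qed (use assms in \<open>auto simp: up_def intro: weq_refl\<close>)

lemma weq_T_cancel: "weq {} (replicate k (T, False) @ replicate k (T, True)) []"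
proof -
  have "inv_word (replicate k (T, True)) = replicate k (T, False)"
    by (simp add: inv_word_def)
  then show ?thesis using weq_inv_word_left[of "{}" "replicate k (T, True)"] by simp
qed

lemma weq_T_cancel': "weq {} (replicate k (T, True) @ replicate k (T, False)) []"
proof -
  have "inv_word (replicate k (T, False)) = replicate k (T, True)"
    by (simp add: inv_word_def)
  then show ?thesis using weq_inv_word_left[of "{}" "replicate k (T, False)"] by simp
qed

lemma weq_up_append: "weq {} (up k u @ up k v) (up k (u @ v))"
  unfolding up_def
  using weq_ctx[OF weq_T_cancel, of "replicate k (T, True) @ u" k "v @ replicate k (T, False)"]
  by simp

lemma weq_up_replicate: "weq {} (concat (replicate n (up k [x]))) (up k (replicate n x))"
proof (induction n)
  case 0
  show ?case using weq_sym[OF weq_T_cancel'] by (simp add: up_def)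
next
  case (Suc n)
  have "weq {} (up k [x] @ concat (replicate n (up k [x]))) (up k [x] @ up k (replicate n x))"
    by (intro weq_append Suc weq_refl)
  then show ?case using weq_up_append[of k "[x]" "replicate n x"] by (auto intro: weq_trans)
qed

text \<open>The loop in \<open>Y\<close> with sides \<open>n M\<^sup>k e\<^sub>i\<close> and \<open>n M\<^sup>k e\<^sub>j\<close> bounds \<open>n\<^sup>2\<close> squares at height \<open>k\<close>, up to an
  annulus of area linear in \<open>n\<close>.\<close>

lemma parallelogram:
  assumes ij: "i < m" "j < m"
  shows "\<exists>D. \<forall>n. \<exists>z. chain_in (edges_Y m M) z \<and> bd1 R z = (\<lambda>_. 0) \<and>
    (\<exists>c. chain_in (cells2_X m M) c \<and> bd2 R c = z \<and> vol c \<le> int (n * n + D * n)) \<and>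
    (\<forall>c a b. chain_in (cells2_Y m M) c \<longrightarrow> bd2 R c = z \<longrightarrow> a < m \<longrightarrow> b < m \<longrightarrow>
      (\<exists>\<mu>. of_int \<mu> = pw (int k) a i * pw (int k) b j - pw (int k) a j * pw (int k) b i \<and>
        int (n * n) * \<bar>\<mu>\<bar> \<le> vol c))"
proof -
  have "\<exists>w N. w \<in> x_words m \<and> Z.fills N w (up k [(X i, True)])" if i: "i < m" for i
  proof -
    obtain w where "w \<in> x_words m" "weq R (up k [(X i, True)]) w"
      using weq_up_x_word[of "[(X i, True)]" k] i by (auto simp: x_words_Cons)
    then show ?thesis using Z.weq_imp_fills weq_sym by blast
  qed
  then obtain u v N N' where u: "u \<in> x_words m" "Z.fills N u (up k [(X i, True)])"
    and v: "v \<in> x_words m" "Z.fills N' v (up k [(X j, True)])"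
    using ij by meson
  \<comment> \<open>Each side occurs twice in the loop, and each copy of \<open>u\<close> or
    \<open>v\<close> is pushed to height \<open>k\<close> at cost \<open>N\<close> or
    \<open>N'\<close>; \<open>D\<close> depends on \<open>k\<close> but not on
    \<open>n\<close>.\<close>
  define D where "D = 2 * (N + N')"
  show ?thesis
  proof (intro exI[of _ D] allI)
    fix n
    define U where "U = concat (replicate n u)"
    define V where "V = concat (replicate n v)"
    let ?xi = "replicate n (X i, True)" and ?xj = "replicate n (X j, True)"
    have UV: "U \<in> x_words m" "V \<in> x_words m"
      using u v by (auto simp: U_def V_def x_words_def)
    have U: "Z.fills (n * N) U (up k ?xi)" unfolding U_def
      using Z.fills_trans[OF Z.fills_concat_replicate[OF u(2)] Z.fills_free[OF weq_up_replicate, of 0]]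
      by simp
    have V: "Z.fills (n * N') V (up k ?xj)" unfolding V_def
      using Z.fills_trans[OF Z.fills_concat_replicate[OF v(2)] Z.fills_free[OF weq_up_replicate, of 0]]
      by simp
    have 1: "Z.fills (n * N + n * N') (U @ V) (up k (?xi @ ?xj))"
      using Z.fills_trans[OF Z.fills_append[OF U V] Z.fills_free[OF weq_up_append, of 0]] by simp
    have 2: "Z.fills (n * N' + n * N) (V @ U) (up k (?xj @ ?xi))"
      using Z.fills_trans[OF Z.fills_append[OF V U] Z.fills_free[OF weq_up_append, of 0]] by simp
    \<comment> \<open>The n by n square of unit cells at height \<open>k\<close>, whose area does
      not involve \<open>k\<close>.\<close>
    have 3: "Z.fills (n * n) (up k (?xi @ ?xj)) (up k (?xj @ ?xi))"
      unfolding up_def by (rule Z.fills_ctx[OF Z.fills_swap_replicate[OF ij]]) simp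
    have "Z.fills (n * N + n * N' + n * n + (n * N' + n * N)) (U @ V) (V @ U)"
      by (rule Z.fills_trans[OF Z.fills_trans[OF 1 3] Z.fills_sym[OF 2]])
    then have fill: "Z.fills (n * n + D * n) (U @ V) (V @ U)"
      by (rule Z.fills_mono) (simp add: D_def algebra_simps)
    define z where "z e = path_chain R (cls R []) (U @ V) e - path_chain R (cls R []) (V @ U) e" for e
    have supp: "chain_supp z \<subseteq> chain_supp (path_chain R (cls R []) (U @ V))
        \<union> chain_supp (path_chain R (cls R []) (V @ U))"
      unfolding z_def[abs_def] by (rule chain_supp_diff)
    have "chain_supp (path_chain R (cls R []) (U @ V)) \<subseteq> edges_Y m M"
      "chain_supp (path_chain R (cls R []) (V @ U)) \<subseteq> edges_Y m M"
      using UV by (simp_all only: chain_supp_path_Y x_words_Nil x_words_append simp_thms)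
    then have "chain_in (edges_Y m M) z"
      unfolding chain_in_def using supp finite_subset[OF supp] by (simp add: subset_trans)
    moreover have "bd1 R z = (\<lambda>_. 0)"
    proof
      fix h
      have "bd1 R z h = bd1 R (path_chain R (cls R []) (U @ V)) h
          - bd1 R (path_chain R (cls R []) (V @ U)) h"
        unfolding bd1_pair z_def[abs_def] by (simp add: pair_diff)
      moreover have "cls R (U @ V) = cls R (V @ U)"
        using Z.fills_weq[OF fill] by (simp add: cls_eq_iff)
      ultimately show "bd1 R z h = 0" by (simp add: bd1_path_chain)
    qed
    moreover have "\<exists>c. chain_in (cells2_X m M) c \<and> bd2 R c = z \<and> vol c \<le> int (n * n + D * n)"
    proof -
      have "cls R [] \<in> range (cls R)" by simp
      then show ?thesis
        using fill unfolding Z.fills_def cells2_X_def verts_X_def z_def[abs_def] fun_eq_iff by blast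
    qed
    moreover have "\<exists>\<mu>. of_int \<mu> = pw (int k) a i * pw (int k) b j - pw (int k) a j * pw (int k) b i \<and>
        int (n * n) * \<bar>\<mu>\<bar> \<le> vol c"
      if c: "chain_in (cells2_Y m M) c" "bd2 R c = z" and ab: "a < m" "b < m" for c a b
    proof -
      \<comment> \<open>\<open>w\<close> acts like the letter read at height \<open>k\<close>, so
        its exponent vector is column \<open>i\<close> of the k-th power.\<close>
      have xu: "of_int (xexp w a) = pw (int k) a i"
        if w: "w \<in> x_words m" "Z.fills N w (up k [(X i, True)])" "i < m" "a < m" for w N i a
        using run_weq[OF Z.fills_weq[OF w(2)], of "(\<lambda>_. 0, 0)"] run_x_word_0[OF w(1,4), of "\<lambda>_. 0"] w(3)
        by (simp add: up_def run_replicate_T)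
      let ?\<mu> = "xexp u a * xexp v b - xexp v a * xexp u b"
      have xn: "xexp (concat (replicate n w)) a = int n * xexp w a" for w a
        by (induction n) (auto simp: algebra_simps)
      \<comment> \<open>The integrals of \<open>U\<close> and \<open>V\<close> from the origin
        cancel; the translation terms leave the signed area of the projected parallelogram.\<close>
      have "pair (omega a b) z = xexp U a * xexp V b - xexp V a * xexp U b"
        using pair_omega_path[of U V a b] pair_omega_path[of V U a b] UV
        unfolding z_def[abs_def]
        by (simp add: pair_diff pair_path_chain_append)
      also have "\<dots> = int (n * n) * ?\<mu>" by (simp add: U_def V_def xn algebra_simps)
      finally have "int (n * n) * \<bar>?\<mu>\<bar> \<le> vol c"
        using omega_le_vol[OF c(1), of a b] by (simp add: c(2) abs_mult)
      moreover have "of_int ?\<mu> = pw (int k) a i * pw (int k) b j - pw (int k) a j * pw (int k) b i"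
        using xu[OF u ij(1)] xu[OF v ij(2)] ab by simp
      ultimately show ?thesis by blast
    qed
    ultimately show "\<exists>z. chain_in (edges_Y m M) z \<and> bd1 R z = (\<lambda>_. 0) \<and>
      (\<exists>c. chain_in (cells2_X m M) c \<and> bd2 R c = z \<and> vol c \<le> int (n * n + D * n)) \<and>
      (\<forall>c a b. chain_in (cells2_Y m M) c \<longrightarrow> bd2 R c = z \<longrightarrow> a < m \<longrightarrow> b < m \<longrightarrow>
        (\<exists>\<mu>. of_int \<mu> = pw (int k) a i * pw (int k) b j - pw (int k) a j * pw (int k) b i \<and>
          int (n * n) * \<bar>\<mu>\<bar> \<le> vol c))"
      by blast
  qed
qed

end


section \<open>Powers of the matrix\<close>

lemma pow_mat_carrier [simp]: "M \<in> carrier_mat n n \<Longrightarrow> M ^\<^sub>m k \<in> carrier_mat n n"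
  by (auto intro: carrier_matI)

lemma mult_mat_entry:
  assumes "A \<in> carrier_mat n n" "B \<in> carrier_mat n n" "a < n" "i < n"
  shows "(A * B) $$ (a, i) = (\<Sum>j<n. A $$ (a, j) * B $$ (j, i))"
  using assms by (simp add: scalar_prod_def atLeast0LessThan)

lemma pow_mat_Suc_entry:
  assumes "M \<in> carrier_mat n n" "a < n" "i < n"
  shows "(M ^\<^sub>m Suc k) $$ (a, i) = (\<Sum>j<n. (M ^\<^sub>m k) $$ (a, j) * M $$ (j, i))"
  using mult_mat_entry[of "M ^\<^sub>m k" n M a i] assms by simp

lemma rat_inverse_exists:
  fixes M :: "int mat"
  assumes M: "M \<in> carrier_mat m m" and "det M \<noteq> 0"
  shows "\<exists>B. B \<in> carrier_mat m m \<and> B * map_mat rat_of_int M = 1\<^sub>m m"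
proof -
  let ?A = "map_mat rat_of_int M"
  have A: "?A \<in> carrier_mat m m" using M by simp
  have "det ?A \<noteq> 0" using assms(2) by (simp add: of_int_hom.hom_det)
  from det_non_zero_imp_unit[OF A this, of undefined] show ?thesis
    by (auto simp: Units_def ring_mat_def)
qed

text \<open>Negative heights use powers of the rational inverse.\<close>

lemma power_rep_rat_exists:
  fixes M :: "int mat"
  assumes M: "M \<in> carrier_mat m m" and "det M \<noteq> 0"
  shows "\<exists>pw :: int \<Rightarrow> nat \<Rightarrow> nat \<Rightarrow> rat. power_rep m M pw"
proof -
  let ?A = "map_mat rat_of_int M"
  have A: "?A \<in> carrier_mat m m" using M by simp
  obtain B where B: "B \<in> carrier_mat m m" "B * ?A = 1\<^sub>m m"
    using rat_inverse_exists[OF assms] by blast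
  define Q where "Q k = (if k \<ge> 0 then ?A ^\<^sub>m nat k else B ^\<^sub>m nat (- k))" for k :: int
  have Q: "Q k \<in> carrier_mat m m" for k using A B by (simp add: Q_def)
  have Q_Suc: "Q (k + 1) = Q k * ?A" for k
  proof (cases "k \<ge> 0")
    case True
    then show ?thesis by (simp add: Q_def nat_add_distrib)
  next
    case False
    then obtain l where l: "k = - int (Suc l)" by (metis int_cases3 linorder_not_le neg_int_cases not_less_iff_gr_or_eq Suc_pred)
    have "B ^\<^sub>m Suc l * ?A = B ^\<^sub>m l"
      using A B by (simp add: assoc_mult_mat[of _ m m _ m _ m])
    moreover have neg: "Q (- int l) = B ^\<^sub>m l" for l
      using A B M by (cases "l = 0") (auto simp: Q_def)
    moreover have "Q (k + 1) = B ^\<^sub>m l" using neg[of l] by (simp add: l)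
    moreover have "Q k = B ^\<^sub>m Suc l" unfolding l by (rule neg)
    ultimately show ?thesis by simp
  qed
  \<comment> \<open>\<open>power_rep\<close> constrains every row index, so rows beyond the matrix
    are padded with zeros.\<close>
  have "power_rep m M (\<lambda>k a i. if a < m then Q k $$ (a, i) else 0)"
  proof
    fix i a :: nat and k :: int assume i: "i < m"
    show "(if a < m then Q 0 $$ (a, i) else 0) = (if a = i then 1 else 0)"
      using i M by (auto simp: Q_def)
    show "(if a < m then Q (k + 1) $$ (a, i) else 0) =
      (\<Sum>j<m. (if a < m then Q k $$ (a, j) else 0) * of_int (M $$ (j, i)))"
      using i M by (simp add: Q_Suc mult_mat_entry[OF Q A])
  qed
  then show ?thesis by blast
qed

text \<open>Reducing exponents modulo \<open>p\<close> keeps negative powers integral; the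
  wrap-around from \<open>p - 1\<close> to 0 is the hypothesis on the p-th power.\<close>

lemma periodic_power_rep_exists:
  fixes M :: "int mat"
  assumes M: "M \<in> carrier_mat m m" and p: "p \<ge> 1" "M ^\<^sub>m p = 1\<^sub>m m"
  shows "\<exists>pw. periodic_power_rep m M pw (int p)"
proof -
  define Q where "Q k = M ^\<^sub>m nat (k mod int p)" for k :: int
  have Q: "Q k \<in> carrier_mat m m" for k using M by (simp add: Q_def)
  have Q_Suc: "Q (k + 1) = Q k * M" for k
  proof -
    have r: "0 \<le> k mod int p" "k mod int p < int p" using p by auto
    have "(k + 1) mod int p = (k mod int p + 1) mod int p" by (simp add: mod_simps)
    then consider "(k + 1) mod int p = k mod int p + 1"
      | "(k + 1) mod int p = 0" "k mod int p = int p - 1"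
      using r by (cases "k mod int p + 1 = int p") (auto simp: mod_pos_pos_trivial)
    then show ?thesis
    proof cases
      case 1
      then show ?thesis using r by (simp add: Q_def nat_add_distrib)
    next
      case 2
      have "M ^\<^sub>m (p - 1) * M = 1\<^sub>m m" using p by (cases p) auto
      moreover have "nat (int p - 1) = p - 1" by simp
      ultimately show ?thesis using 2 M by (simp add: Q_def)
    qed
  qed
  have "periodic_power_rep m M (\<lambda>k a i. if a < m then Q k $$ (a, i) else 0) (int p)"
  proof
    fix i a :: nat and k :: int assume i: "i < m"
    show "(if a < m then Q 0 $$ (a, i) else 0) = (if a = i then 1 else 0)"
      using i M by (auto simp: Q_def)
    show "(if a < m then Q (k + 1) $$ (a, i) else 0) =
      (\<Sum>j<m. (if a < m then Q k $$ (a, j) else 0) * of_int (M $$ (j, i)))"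
      using i M by (simp add: Q_Suc mult_mat_entry[OF Q M])
  next
    fix k :: int
    have "Q (k + int p) = Q k" by (simp add: Q_def)
    then show "(\<lambda>a i. if a < m then Q (k + int p) $$ (a, i) else 0) =
      (\<lambda>a i. if a < m then Q k $$ (a, i) else 0)"
      by (simp only:)
  qed (use p in simp)
  then show ?thesis by blast
qed

section \<open>Second exterior powers of the matrix powers\<close>

context power_rep
begin

lemma pw_add:
  assumes M: "M \<in> carrier_mat m m" and "i < m"
  shows "pw (k + int l) a i = (\<Sum>j<m. pw k a j * of_int ((M ^\<^sub>m l) $$ (j, i)))"
  using assms(2)
proof (induction l arbitrary: i)
  case 0
  have "(\<Sum>j<m. pw k a j * of_int ((M ^\<^sub>m 0) $$ (j, i))) = (\<Sum>j<m. if i = j then pw k a j else 0)"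
    by (intro sum.cong) (use 0 M in auto)
  then show ?case using 0 by simp
next
  case (Suc l)
  have "pw (k + int (Suc l)) a i = (\<Sum>c<m. pw (k + int l) a c * of_int (M $$ (c, i)))"
    using pw_Suc[OF Suc.prems, of "k + int l"] by (simp add: algebra_simps)
  also have "\<dots> = (\<Sum>c<m. \<Sum>j<m. pw k a j * of_int ((M ^\<^sub>m l) $$ (j, c)) * of_int (M $$ (c, i)))"
    by (intro sum.cong) (simp_all add: Suc.IH sum_distrib_right)
  also have "\<dots> = (\<Sum>j<m. \<Sum>c<m. pw k a j * of_int ((M ^\<^sub>m l) $$ (j, c)) * of_int (M $$ (c, i)))"
    by (rule sum.swap)
  also have "\<dots> = (\<Sum>j<m. pw k a j * of_int ((M ^\<^sub>m Suc l) $$ (j, i)))"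
    by (intro sum.cong refl)
      (simp add: pow_mat_Suc_entry[OF M _ Suc.prems] sum_distrib_left mult.assoc del: pow_mat.simps)
  finally show ?case .
qed

lemma pw_nat:
  assumes M: "M \<in> carrier_mat m m" and "a < m" "i < m"
  shows "pw (int l) a i = of_int ((M ^\<^sub>m l) $$ (a, i))"
proof -
  have "pw (0 + int l) a i = (\<Sum>j<m. pw 0 a j * of_int ((M ^\<^sub>m l) $$ (j, i)))"
    by (rule pw_add) fact+
  also have "\<dots> = (\<Sum>j<m. if a = j then of_int ((M ^\<^sub>m l) $$ (j, i)) else 0)"
    by (intro sum.cong) (auto simp: pw_0)
  finally show ?thesis using assms by simp
qed

text \<open>Entries of the second exterior power of the k-th power.\<close>

definition minor2 :: "int \<Rightarrow> nat \<Rightarrow> nat \<Rightarrow> nat \<Rightarrow> nat \<Rightarrow> 'a" where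
  "minor2 k a b i j = pw k a i * pw k b j - pw k a j * pw k b i"

text \<open>Functoriality of the exterior square: no Cauchy-Binet is needed when summing over all
  ordered pairs \<open>(c, d)\<close>.\<close>

lemma minor2_add:
  assumes M: "M \<in> carrier_mat m m" and ij: "i < m" "j < m"
  shows "minor2 (h + int l) a b i j = (\<Sum>c<m. \<Sum>d<m. pw h a c * pw h b d * minor2 (int l) c d i j)"
proof -
  have pw: "pw (h + int l) a i = (\<Sum>c<m. pw h a c * pw (int l) c i)" if "i < m" for a i
    using pw_add[OF M that] pw_nat[OF M _ that] by simp
  show ?thesis
    unfolding minor2_def
    by (simp add: pw ij sum_product sum_subtractf[symmetric] algebra_simps)
qed

text \<open>Multiply on the left by the exterior square at height \<open>- k\<close>; this is where
  invertibility over the coefficient ring enters.\<close>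

lemma minor2_eq_imp:
  assumes M: "M \<in> carrier_mat m m" and ij: "i < m" "j < m" and "k \<le> l"
    and eq: "\<And>c d. c < m \<Longrightarrow> d < m \<Longrightarrow> minor2 (int k) c d i j = minor2 (int l) c d i j"
  shows "minor2 (int (l - k)) a b i j = minor2 0 a b i j"
proof -
  have "minor2 (- int k + int l) a b i j = minor2 (- int k + int k) a b i j"
    unfolding minor2_add[OF M ij] using eq by simp
  then show ?thesis using assms(4) by (simp add: of_nat_diff)
qed

end

text \<open>If \<open>\<Lambda>\<^sup>2 A = I\<close> then \<open>A e\<^sub>i\<close> lies in the intersection of the planes spanned by \<open>e\<^sub>i, e\<^sub>j\<close> for
  \<open>j \<noteq> i\<close>, which is a line since \<open>m \<ge> 3\<close>; hence \<open>A = \<plusminus>I\<close>.\<close>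

lemma wedge_square_identity_imp_involution:
  fixes A :: "nat \<Rightarrow> nat \<Rightarrow> 'a::idom"
  assumes m: "m \<ge> 3"
    and minors: "\<And>a b i j. a < m \<Longrightarrow> b < m \<Longrightarrow> i < m \<Longrightarrow> j < m \<Longrightarrow>
      A a i * A b j - A a j * A b i
        = (if a = i \<and> b = j then 1 else 0) - (if a = j \<and> b = i then 1 else 0)"
    and "a < m" "i < m"
  shows "(\<Sum>j<m. A a j * A j i) = (if a = i then 1 else 0)"
proof -
  have third: "\<exists>j<m. j \<noteq> c \<and> j \<noteq> i" for c i :: nat
  proof -
    have "card ({..<m} - {c, i}) \<ge> m - 2"
      using diff_card_le_card_Diff[of "{c, i}" "{..<m}"] card_insert_le_m1[of 2 "{i}" c] by simp
    then have "{..<m} - {c, i} \<noteq> {}" using m by (metis card.empty One_nat_def Suc_1 diff_is_0_eq le_zero_eq not_less_eq_eq numeral_3_eq_3)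
    then show ?thesis by blast
  qed
  have off: "A c i = 0" if c: "c < m" "i < m" "c \<noteq> i" for c i
  proof -
    obtain j where j: "j < m" "j \<noteq> c" "j \<noteq> i" using third by blast
    have 1: "A i i * A j j - A i j * A j i = 1" using minors[of i j i j] c j by auto
    have 2: "A c i * A j j - A c j * A j i = 0" using minors[of c j i j] c j by auto
    have 3: "A c i * A i j - A c j * A i i = 0" using minors[of c i i j] c j by auto
    \<comment> \<open>Laplace expansion of a 3 by 3 determinant with rows c, i, j and column i
      repeated, which is zero.\<close>
    have "A c i = A c i * (A i i * A j j - A i j * A j i)" by (simp add: 1)
    also have "\<dots> = A i i * (A c i * A j j - A c j * A j i) - A j i * (A c i * A i j - A c j * A i i)"
      by (simp add: algebra_simps)
    finally show ?thesis by (simp add: 2 3)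
  qed
  have diag2: "A c c * A d d = 1" if "c < m" "d < m" "c \<noteq> d" for c d
    using minors[of c d c d] off[of c d] that by auto
  have diag: "A i i * A i i = 1" if i: "i < m" for i
  proof -
    obtain j where j: "j < m" "j \<noteq> i" using third by blast
    obtain l where l: "l < m" "l \<noteq> i" "l \<noteq> j" using third by blast
    \<comment> \<open>Three distinct indices turn the pairwise products 1 into a square equal to
      1.\<close>
    have "A i i * A i i = (A i i * A i i) * (A j j * A l l)" using diag2[of j l] j l by simp
    also have "\<dots> = (A i i * A j j) * (A i i * A l l)" by (simp add: algebra_simps)
    finally show ?thesis using diag2[of i j] diag2[of i l] i j l by simp
  qed
  have "(\<Sum>j<m. A a j * A j i) = (\<Sum>j<m. if a = j then A a j * A j i else 0)"
    using assms(3,4) off by (intro sum.cong) auto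
  then show ?thesis using assms(3,4) off[of a i] diag[of i] by auto
qed

lemma bounded_minors_imp_finite_order:
  fixes pw :: "int \<Rightarrow> nat \<Rightarrow> nat \<Rightarrow> 'a::{idom,ring_char_0}"
  assumes m: "m \<ge> 3" and M: "M \<in> carrier_mat m m" and "power_rep m M pw"
    and bound: "\<And>k a b i j. a < m \<Longrightarrow> b < m \<Longrightarrow> i < m \<Longrightarrow> j < m \<Longrightarrow>
      \<exists>\<mu>. \<bar>\<mu>\<bar> \<le> B \<and> of_int \<mu> = pw (int k) a i * pw (int k) b j - pw (int k) a j * pw (int k) b i"
  shows "\<exists>j\<ge>1. M ^\<^sub>m j = 1\<^sub>m m"
proof -
  interpret power_rep m M pw by fact
  let ?I = "{..<m} \<times> {..<m} \<times> {..<m} \<times> {..<m}"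
  \<comment> \<open>Restriction to the index range puts all \<open>f k\<close> into a finite
    function space, so two heights must agree.\<close>
  define f where "f k = restrict (\<lambda>(a, b, i, j). minor2 (int k) a b i j) ?I" for k
  have "range f \<subseteq> ?I \<rightarrow>\<^sub>E of_int ` {-B..B}"
  proof
    fix g assume "g \<in> range f"
    then obtain k where g: "g = f k" by blast
    have "minor2 (int k) a b i j \<in> of_int ` {-B..B}" if abij: "a < m" "b < m" "i < m" "j < m" for a b i j
    proof -
      obtain \<mu> where "\<bar>\<mu>\<bar> \<le> B" "of_int \<mu> = minor2 (int k) a b i j"
        using bound[OF abij, of k] unfolding minor2_def by blast
      then show ?thesis by (intro image_eqI[of _ _ \<mu>]) auto
    qed
    then show "g \<in> ?I \<rightarrow>\<^sub>E of_int ` {-B..B}" by (auto simp: g f_def)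
  qed
  then have "finite (range f)"
    by (rule finite_subset) (intro finite_PiE, auto)
  then have "\<not> inj f" using finite_imageD infinite_UNIV_nat by blast
  then obtain k l where "f k = f l" "k < l" unfolding inj_def by (metis nat_neq_iff)
  then have eq: "minor2 (int k) c d i j = minor2 (int l) c d i j"
    if "c < m" "d < m" "i < m" "j < m" for c d i j
    using that by (auto simp: f_def dest: fun_cong[of _ _ "(c, d, i, j)"])
  let ?p = "l - k"
  have minors: "minor2 (int ?p) a b i j = minor2 0 a b i j" if "i < m" "j < m" for a b i j
    using minor2_eq_imp[OF M that, of k l] eq that \<open>k < l\<close> by simp
  have if_prod: "(if P then 1 else 0) * (if Q then 1 else 0) = (if P \<and> Q then 1 else 0 :: 'a)" for P Q
    by simp
  have inv: "(\<Sum>j<m. pw (int ?p) a j * pw (int ?p) j i) = (if a = i then 1 else 0)"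
    if "a < m" "i < m" for a i
  proof (rule wedge_square_identity_imp_involution[OF m _ that])
    fix a b i j assume abij: "a < m" "b < m" "i < m" "j < m"
    have "minor2 0 a b i j = (if a = i \<and> b = j then 1 else 0) - (if a = j \<and> b = i then 1 else 0)"
      by (simp only: minor2_def pw_0 abij if_prod)
    with minors[OF abij(3,4), of a b] show "pw (int ?p) a i * pw (int ?p) b j - pw (int ?p) a j * pw (int ?p) b i
        = (if a = i \<and> b = j then 1 else 0) - (if a = j \<and> b = i then 1 else 0)"
      unfolding minor2_def by (rule trans)
  qed
  \<comment> \<open>The power at \<open>?p\<close> is only known to be an involution, hence the
    doubled exponent.\<close>
  have "M ^\<^sub>m (?p + ?p) = 1\<^sub>m m"
  proof (rule eq_matI)
    fix a i assume "a < dim_row (1\<^sub>m m :: int mat)" "i < dim_col (1\<^sub>m m :: int mat)"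
    then have ai: "a < m" "i < m" by auto
    have "(of_int ((M ^\<^sub>m (?p + ?p)) $$ (a, i)) :: 'a) = pw (int ?p + int ?p) a i"
      using pw_nat[OF M ai, of "?p + ?p"] by simp
    also have "\<dots> = (\<Sum>j<m. pw (int ?p) a j * pw (int ?p) j i)"
      unfolding pw_add[OF M ai(2)] using pw_nat[OF M _ ai(2)] by (intro sum.cong) auto
    also have "\<dots> = of_int (if a = i then 1 else 0)" using inv[OF ai] by simp
    finally show "(M ^\<^sub>m (?p + ?p)) $$ (a, i) = 1\<^sub>m m $$ (a, i)"
      using ai by (simp only: of_int_eq_iff) simp
  qed (use M in auto)
  then show ?thesis using \<open>k < l\<close> by (intro exI[of _ "?p + ?p"]) auto
qed

section \<open>Volume distortion\<close>

lemma fillvol_nonneg: "0 \<le> fillvol R F z"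
  unfolding fillvol_def by (rule Inf_greatest) (auto simp: vol_nonneg)

lemma fillvol_le:
  assumes "chain_in F c" "bd2 R c = z"
  shows "fillvol R F z \<le> ereal (of_int (vol c))"
  unfolding fillvol_def by (rule Inf_lower) (use assms in blast)

lemma VolD_ge:
  assumes "chain_in (edges_Y m M) z" "bd1 (gamma_rels m M) z = (\<lambda>_. 0)"
    and "fillvol (gamma_rels m M) (cells2_X m M) z \<le> ereal n"
  shows "fillvol (gamma_rels m M) (cells2_Y m M) z \<le> VolD m M n"
  unfolding VolD_def by (rule Sup_upper) (use assms in blast)

lemma VolD_nonneg: assumes "0 \<le> x" shows "0 \<le> VolD m M x"
proof -
  \<comment> \<open>The zero cycle is admissible, so the supremum is not that of the empty
    set.\<close>
  have "fillvol (gamma_rels m M) (cells2_X m M) (\<lambda>_. 0) \<le> ereal (of_int (vol (\<lambda>_ :: word set \<times> word. 0)))"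
    by (rule fillvol_le) (auto simp: chain_in_def bd2_pair[abs_def])
  then have "fillvol (gamma_rels m M) (cells2_X m M) (\<lambda>_. 0) \<le> ereal x"
    using assms by (simp add: order_trans)
  then have "fillvol (gamma_rels m M) (cells2_Y m M) (\<lambda>_. 0) \<le> VolD m M x"
    by (intro VolD_ge) (auto simp: chain_in_def bd1_pair)
  then show ?thesis using fillvol_nonneg order_trans by blast
qed

lemma finite_order_imp_VolD_linear:
  assumes M: "M \<in> carrier_mat m m" and p: "p \<ge> 1" "M ^\<^sub>m p = 1\<^sub>m m"
  shows "\<exists>N::nat. \<forall>x. VolD m M x \<le> ereal (real N * (x + 1))"
proof -
  obtain pw where "periodic_power_rep m M pw (int p)"
    using periodic_power_rep_exists[OF M p] by blast
  then interpret periodic_power_rep m M pw "int p" .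
  obtain N where N: "\<And>z c. chain_in (edges_Y m M) z \<Longrightarrow> chain_in (cells2_X m M) c \<Longrightarrow> bd2 R c = z \<Longrightarrow>
     (\<exists>c'. chain_in (cells2_Y m M) c' \<and> bd2 R c' = z \<and> vol c' \<le> int N * vol c)"
    using fill_transfer by blast
  have "fillvol R (cells2_Y m M) z \<le> ereal (real N * (x + 1))"
    if z: "chain_in (edges_Y m M) z" "fillvol R (cells2_X m M) z \<le> ereal x" for z x
  proof -
    \<comment> \<open>The slack 1 yields an actual filling without showing that the infimum is
      attained.\<close>
    have "fillvol R (cells2_X m M) z < ereal (x + 1)"
      using z(2) by (rule le_less_trans) simp
    then obtain c where c: "chain_in (cells2_X m M) c" "bd2 R c = z" "real_of_int (vol c) < x + 1"
      unfolding fillvol_def Inf_less_iff by auto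
    then obtain c' where c': "chain_in (cells2_Y m M) c'" "bd2 R c' = z" "vol c' \<le> int N * vol c"
      using N[OF z(1)] by blast
    have "real_of_int (vol c') \<le> real_of_int (int N * vol c)"
      using c'(3) by (simp only: of_int_le_iff)
    also have "\<dots> \<le> real N * (x + 1)" using c(3) by (simp add: mult_left_mono)
    finally have "ereal (of_int (vol c')) \<le> ereal (real N * (x + 1))" by simp
    then show ?thesis using fillvol_le[OF c'(1,2)] order_trans by blast
  qed
  then have "VolD m M x \<le> ereal (real N * (x + 1))" for x
    unfolding VolD_def by (intro Sup_least) blast
  then show ?thesis by blast
qed

text \<open>Compare both fillings of the parallelogram loop as n grows: the terms with
  \<open>D\<close> and \<open>B\<close> are of lower order, so the bound on the minor depends on
  \<open>A\<close> alone and is uniform in \<open>k\<close>.\<close>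

lemma VolD_linear_imp_bounded_minors:
  fixes pw :: "int \<Rightarrow> nat \<Rightarrow> nat \<Rightarrow> 'a::{comm_ring_1,ring_char_0}"
  assumes "power_rep m M pw" and lin: "\<And>x. x \<ge> 0 \<Longrightarrow> VolD m M x \<le> ereal (A * x + B)"
    and ab: "a < m" "b < m" and ij: "i < m" "j < m"
  shows "\<exists>\<mu>. \<bar>\<mu>\<bar> \<le> \<lceil>A\<rceil> \<and> of_int \<mu> = pw (int k) a i * pw (int k) b j - pw (int k) a j * pw (int k) b i"
proof -
  interpret faithful_power_rep m M pw using assms(1) by (simp add: faithful_power_rep_def)
  let ?w = "pw (int k) a i * pw (int k) b j - pw (int k) a j * pw (int k) b i"
  from parallelogram[OF ij, of k] obtain D where D: "\<And>n. \<exists>z. chain_in (edges_Y m M) z \<and> bd1 R z = (\<lambda>_. 0) \<and>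
    (\<exists>c. chain_in (cells2_X m M) c \<and> bd2 R c = z \<and> vol c \<le> int (n * n + D * n)) \<and>
    (\<forall>c a b. chain_in (cells2_Y m M) c \<longrightarrow> bd2 R c = z \<longrightarrow> a < m \<longrightarrow> b < m \<longrightarrow>
      (\<exists>\<mu>. of_int \<mu> = pw (int k) a i * pw (int k) b j - pw (int k) a j * pw (int k) b i \<and>
        int (n * n) * \<bar>\<mu>\<bar> \<le> vol c))"
    by blast
  have main: "\<exists>\<mu>. of_int \<mu> = ?w \<and> real (n * n) * \<bar>real_of_int \<mu>\<bar> \<le> A * real (n * n + D * n) + B" for n
  proof -
    obtain z c where z: "chain_in (edges_Y m M) z" "bd1 R z = (\<lambda>_. 0)"
      and c: "chain_in (cells2_X m M) c" "bd2 R c = z" "vol c \<le> int (n * n + D * n)"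
      and low: "\<And>c. chain_in (cells2_Y m M) c \<Longrightarrow> bd2 R c = z \<Longrightarrow>
        \<exists>\<mu>. of_int \<mu> = ?w \<and> int (n * n) * \<bar>\<mu>\<bar> \<le> vol c"
      using D[of n] ab by blast
    let ?x = "real (n * n + D * n)"
    have "real_of_int (vol c) \<le> real_of_int (int (n * n + D * n))" using c(3) by (simp only: of_int_le_iff)
    then have "fillvol R (cells2_X m M) z \<le> ereal ?x"
      using fillvol_le[OF c(1,2)] by (intro order_trans[OF fillvol_le[OF c(1,2)]]) simp
    then have Y: "fillvol R (cells2_Y m M) z \<le> ereal (A * ?x + B)"
      using VolD_ge[OF z] lin[of ?x] by (meson of_nat_0_le_iff order_trans)
    \<comment> \<open>A finite infimum guarantees some filling in Y, which is needed to extract the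
      integer value of the minor.\<close>
    then have "fillvol R (cells2_Y m M) z \<noteq> \<infinity>" by auto
    then have "fillvol R (cells2_Y m M) z < \<infinity>" by simp
    then obtain c0 where "chain_in (cells2_Y m M) c0" "bd2 R c0 = z"
      unfolding fillvol_def Inf_less_iff by auto
    then obtain \<mu> where \<mu>: "of_int \<mu> = ?w" using low by blast
    have "ereal (real (n * n) * \<bar>real_of_int \<mu>\<bar>) \<le> fillvol R (cells2_Y m M) z"
      unfolding fillvol_def
    proof (rule Inf_greatest)
      fix v assume "v \<in> {ereal (of_int (vol c)) |c. chain_in (cells2_Y m M) c \<and> bd2 R c = z}"
      then obtain c1 where v: "v = ereal (of_int (vol c1))" and c1: "chain_in (cells2_Y m M) c1" "bd2 R c1 = z"
        by blast
      then obtain \<mu>' where \<mu>': "of_int \<mu>' = ?w" "int (n * n) * \<bar>\<mu>'\<bar> \<le> vol c1" using low by blast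
      then have "int (n * n) * \<bar>\<mu>\<bar> \<le> vol c1" using \<mu> by (metis of_int_eq_iff)
      then have "real_of_int (int (n * n) * \<bar>\<mu>\<bar>) \<le> real_of_int (vol c1)" by (simp only: of_int_le_iff)
      then show "ereal (real (n * n) * \<bar>real_of_int \<mu>\<bar>) \<le> v" by (simp add: v)
    qed
    then have "real (n * n) * \<bar>real_of_int \<mu>\<bar> \<le> A * ?x + B" using Y order_trans by fastforce
    then show ?thesis using \<mu> by blast
  qed
  then obtain \<mu> where \<mu>: "of_int \<mu> = ?w" by blast
  have bd: "real (n * n) * \<bar>real_of_int \<mu>\<bar> \<le> A * real (n * n + D * n) + B" for n
    using main[of n] \<mu> by (metis of_int_eq_iff)
  have "\<bar>real_of_int \<mu>\<bar> \<le> A"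
  proof (rule ccontr)
    assume "\<not> \<bar>real_of_int \<mu>\<bar> \<le> A"
    then have pos: "\<bar>real_of_int \<mu>\<bar> - A > 0" by simp
    \<comment> \<open>Past this quotient the quadratic excess of \<open>\<bar>\<mu>\<bar>\<close>
      over \<open>A\<close> beats the lower-order terms.\<close>
    obtain n :: nat where n: "(\<bar>A\<bar> * real D + \<bar>B\<bar>) / (\<bar>real_of_int \<mu>\<bar> - A) < real n"
      using reals_Archimedean2 by blast
    have "0 \<le> (\<bar>A\<bar> * real D + \<bar>B\<bar>) / (\<bar>real_of_int \<mu>\<bar> - A)" using pos by simp
    then have n1: "real n \<ge> 1" using n by (cases n) auto
    have "\<bar>A\<bar> * real D + \<bar>B\<bar> < real n * (\<bar>real_of_int \<mu>\<bar> - A)"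
      using n pos by (simp add: pos_divide_less_eq)
    then have "real n * (\<bar>A\<bar> * real D + \<bar>B\<bar>) < real n * (real n * (\<bar>real_of_int \<mu>\<bar> - A))"
      using n1 by simp
    moreover have "real n * (real n * (\<bar>real_of_int \<mu>\<bar> - A)) \<le> A * (real D * real n) + B"
      using bd[of n] by (simp add: algebra_simps)
    moreover have "A * (real D * real n) \<le> \<bar>A\<bar> * (real D * real n)" by (simp add: mult_right_mono)
    moreover have "B \<le> real n * \<bar>B\<bar>"
      using mult_right_mono[OF n1, of "\<bar>B\<bar>"] by simp
    ultimately show False by (simp add: algebra_simps)
  qed
  then have "\<bar>\<mu>\<bar> \<le> \<lceil>A\<rceil>" by linarith
  then show ?thesis using \<mu> by blast
qed

theorem mainTheorem15:
  fixes m :: nat and M :: "int mat"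
  assumes "m \<ge> 3" and "M \<in> carrier_mat m m" and "det M \<noteq> 0"
  shows "asymp_equiv (VolD m M) (\<lambda>n. ereal n) \<longleftrightarrow> (\<exists>j\<ge>1. M ^\<^sub>m j = 1\<^sub>m m)"
proof
  assume "asymp_equiv (VolD m M) (\<lambda>n. ereal n)"
  then obtain C where C: "\<And>x. x \<ge> 0 \<Longrightarrow>
      VolD m M x \<le> ereal C * ereal (C * x + C) + ereal (C * x + C)"
    unfolding asymp_equiv_def by blast
  have lin: "VolD m M x \<le> ereal ((C * C + C) * x + (C * C + C))" if "x \<ge> 0" for x
    using C[OF that] by (simp add: algebra_simps)
  obtain pw :: "int \<Rightarrow> nat \<Rightarrow> nat \<Rightarrow> rat" where pw: "power_rep m M pw"
    using power_rep_rat_exists[OF assms(2,3)] by blast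
  show "\<exists>j\<ge>1. M ^\<^sub>m j = 1\<^sub>m m"
    by (rule bounded_minors_imp_finite_order[OF assms(1,2) pw])
      (rule VolD_linear_imp_bounded_minors[OF pw lin])
next
  assume "\<exists>j\<ge>1. M ^\<^sub>m j = 1\<^sub>m m"
  then obtain N :: nat where N: "\<And>x. VolD m M x \<le> ereal (real N * (x + 1))"
    using finite_order_imp_VolD_linear[OF assms(2)] by blast
  \<comment> \<open>Adding 1 keeps the constant positive even for \<open>N = 0\<close>.\<close>
  let ?C = "real N + 1"
  show "asymp_equiv (VolD m M) (\<lambda>n. ereal n)"
    unfolding asymp_equiv_def
  proof (intro exI[of _ ?C] conjI allI impI)
    fix x :: real assume x: "x \<ge> 0"
    have "real N * (x + 1) \<le> ?C * (?C * x + ?C) + (?C * x + ?C)"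
      using x by (simp add: algebra_simps)
    then show "VolD m M x \<le> ereal ?C * ereal (?C * x + ?C) + ereal (?C * x + ?C)"
      using N[of x] by (simp add: order_trans[of _ "ereal (real N * (x + 1))"])
    \<comment> \<open>The additive linear term already dominates \<open>x\<close>, so only
      nonnegativity of \<open>VolD\<close> is used here.\<close>
    have "x \<le> ?C * x + ?C" using x by (simp add: algebra_simps)
    moreover have "0 \<le> ereal ?C * VolD m M (?C * x + ?C)"
      using x by (intro ereal_0_le_mult VolD_nonneg) auto
    ultimately show "ereal x \<le> ereal ?C * VolD m M (?C * x + ?C) + ereal (?C * x + ?C)"
      by (metis add_increasing ereal_less_eq(3))
  qed simp
qed

end
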